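(* Let $N\ge 1$, let $\Omega\subset\mathbb{R}^N$ be a bounded Lipschitz domain, let $s\in(0,1)$, $T>0$ and $\alpha\ge 1$. Let $q\in L^\infty(\Omega)$ with $q\ge 0$ in $\Omega$, and assume that there exist an open subset $O$ of $\Omega$ (nonempty) and a constant $q_0>0$ such that $q\ge q_0$ a.e. in $O$. Consider the problem $$(P)\qquad \begin{cases} u_t+(-\Delta)^s u=q(x)|u|^{\alpha-1}u & \text{in }(0,T)\times\Omega,\\ u=0 & \text{in }(0,T)\times(\mathbb{R}^N\setminus\Omega),\\ u=0&\text{at }t=0.\end{cases}$$ The following assertions hold: (i) If $\alpha=1$, then the trivial solution $u\equiv0$ is the unique solution in the class of finite energy solutions of $(P)$. (ii) If $\alpha>1$, then the trivial solution $u\equiv 0$ is the unique solution in the class of bounded finite energy solutions of $(P)$.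
   Context: Notation. $X_0^s(\Omega)=\{u\in H^s(\mathbb{R}^N): u=0 \text{ a.e. in }\mathbb{R}^N\setminus\Omega\}$, where $H^s(\mathbb{R}^N)$ is the space of $u\in L^2(\mathbb{R}^N)$ with $\iint_{\mathbb{R}^N\times\mathbb{R}^N}\frac{|u(x)-u(y)|^2}{|x-y|^{N+2s}}\,dx\,dy<+\infty$. It is a separable Hilbert space with scalar product $$\mathcal{E}(u,v)=\frac{c_{N,s}}{2}\iint_{\mathbb{R}^N\times\mathbb{R}^N}\frac{(u(x)-u(y))(v(x)-v(y))}{|x-y|^{N+2s}}\,dx\,dy,\qquad c_{N,s}=\frac{s2^{2s}\Gamma(\frac{N+2s}{2})}{\pi^{N/2}\Gamma(1-s)},$$ and norm $\|u\|_{X_0^s(\Omega)}=\mathcal{E}(u,u)^{1/2}$. $(X_0^s(\Omega))^*$ is its dual, $\langle\cdot,\cdot\rangle$ the duality pairing between $(X_0^s(\Omega))^*$ and $X_0^s(\Omega)$; one uses the Gelfand triple $X_0^s(\Omega)\hookrightarrow L^2(\Omega)\hookrightarrow (X_0^s(\Omega))^*$, so that $\langle u,v\rangle=\int_\Omega uv\,dx$ for $u\in L^2(\Omega)$, $v\in X_0^s(\Omega)$. $L^2((0,T)\to X_0^s(\Omega))$ and $L^2((0,T)\to (X_0^s(\Omega))^* )$ are the usual Bochner spaces. For $u\in L^2((0,T)\to X_0^s(\Omega))$, $u_t$ denotes the distributional time derivative; $u_t\in L^2((0,T)\to(X_0^s(\Omega))^* )$ means that there is an element $u_t$ of this space with $\int_0^T\langle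 u_t(t),v\rangle\varphi(t)\,dt=-\int_0^T\big(\int_\Omega u(t,x)v(x)\,dx\big)\varphi'(t)\,dt$ for all $v\in X_0^s(\Omega)$, $\varphi\in C_0^\infty(0,T)$. In that case $u\in C([0,T]\to L^2(\Omega))$ (after modification on a null set of times). Finite energy solution of $(P)$: a function $u$ such that $u\in L^2((0,T)\to X_0^s(\Omega))$, $u_t\in L^2((0,T)\to(X_0^s(\Omega))^* )$, $\|u(t,\cdot)\|_{L^2(\Omega)}\to0$ as $t\to0+$, and $$\int_0^T\langle u_t(t),\varphi(t,\cdot)\rangle\,dt+\int_0^T\mathcal{E}(u(t,\cdot),\varphi(t,\cdot))\,dt=\int_0^T\int_\Omega q(x)|u(t,x)|^{\alpha-1}u(t,x)\varphi(t,x)\,dx\,dt$$ for all $\varphi\in L^2((0,T)\to X_0^s(\Omega))$. "Bounded" means essentially bounded on $(0,T)\times\Omega$. *)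

theory Defs
  imports "HOL-Analysis.Analysis"
begin

text \<open>
  Elements of function spaces are represented by functions rather than by classes modulo null
  sets; all notions below are invariant under changing a function of the space variable on a null
  set, and a function of time on a null set of times.
\<close>

section \<open>Bounded Lipschitz domains\<close>

text \<open>
  Near each boundary point the set is the strict epigraph, in some direction \<open>\<nu>\<close>, of a Lipschitz
  function on the hyperplane orthogonal to \<open>\<nu>\<close>.
\<close>

definition lipschitz_domain :: "'a::euclidean_space set \<Rightarrow> bool" where
  "lipschitz_domain \<Omega> \<longleftrightarrow>
     open \<Omega> \<and> connected \<Omega> \<and> \<Omega> \<noteq> {} \<and>
     (\<forall>z\<in>frontier \<Omega>. \<exists>r>0. \<exists>\<nu> L. \<exists>\<gamma>::'a \<Rightarrow> real.
        norm \<nu> = 1 \<and> L-lipschitz_on {y. y \<bullet> \<nu> = 0} \<gamma> \<and>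
        \<Omega> \<inter> ball z r = {x \<in> ball z r. \<gamma> (x - (x \<bullet> \<nu>) *\<^sub>R \<nu>) < x \<bullet> \<nu>})"

section \<open>The fractional Sobolev space and its dual\<close>

definition L2_fun :: "'a::euclidean_space set \<Rightarrow> ('a \<Rightarrow> real) \<Rightarrow> bool" where
  "L2_fun A u \<longleftrightarrow>
     u \<in> borel_measurable (lebesgue_on A) \<and> integrable (lebesgue_on A) (\<lambda>x. (u x)\<^sup>2)"

definition L2_norm_on :: "'a::euclidean_space set \<Rightarrow> ('a \<Rightarrow> real) \<Rightarrow> real" where
  "L2_norm_on A u = sqrt (LINT x|lebesgue_on A. (u x)\<^sup>2)"

text \<open>The value of the kernel on the diagonal is irrelevant (it is \<open>0\<close>, as \<open>0 / 0 = 0\<close>).\<close>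

definition frac_kernel ::
    "real \<Rightarrow> ('a::euclidean_space \<Rightarrow> real) \<Rightarrow> ('a \<Rightarrow> real) \<Rightarrow> 'a \<times> 'a \<Rightarrow> real" where
  "frac_kernel s u v = (\<lambda>(x, y).
     (u x - u y) * (v x - v y) / norm (x - y) powr (real DIM('a) + 2 * s))"

definition Hs_space :: "real \<Rightarrow> ('a::euclidean_space \<Rightarrow> real) set" where
  "Hs_space s = {u. L2_fun UNIV u \<and> integrable lebesgue (frac_kernel s u u)}"

definition X0 :: "real \<Rightarrow> 'a::euclidean_space set \<Rightarrow> ('a \<Rightarrow> real) set" where
  "X0 s \<Omega> = {u \<in> Hs_space s. AE x in lebesgue. x \<notin> \<Omega> \<longrightarrow> u x = 0}"

definition frac_const :: "nat \<Rightarrow> real \<Rightarrow> real" where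
  "frac_const N s =
     s * 2 powr (2 * s) * Gamma ((real N + 2 * s) / 2) / (pi powr (real N / 2) * Gamma (1 - s))"

definition energy ::
    "real \<Rightarrow> ('a::euclidean_space \<Rightarrow> real) \<Rightarrow> ('a \<Rightarrow> real) \<Rightarrow> real" where
  "energy s u v = frac_const DIM('a) s / 2 * (LINT z|lebesgue. frac_kernel s u v z)"

definition X0_norm :: "real \<Rightarrow> ('a::euclidean_space \<Rightarrow> real) \<Rightarrow> real" where
  "X0_norm s u = sqrt (energy s u u)"

text \<open>
  Functionals are total HOL functions; only their values on \<open>X0 s \<Omega>\<close> are relevant. Boundedness
  and linearity imply that they respect equality almost everywhere.
\<close>

definition X0_dual :: "real \<Rightarrow> 'a::euclidean_space set \<Rightarrow> (('a \<Rightarrow> real) \<Rightarrow> real) set" where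
  "X0_dual s \<Omega> = {F.
     (\<forall>v\<in>X0 s \<Omega>. \<forall>w\<in>X0 s \<Omega>. F (\<lambda>x. v x + w x) = F v + F w) \<and>
     (\<forall>c. \<forall>v\<in>X0 s \<Omega>. F (\<lambda>x. c * v x) = c * F v) \<and>
     (\<exists>C. \<forall>v\<in>X0 s \<Omega>. \<bar>F v\<bar> \<le> C * X0_norm s v)}"

definition X0_dual_norm ::
    "real \<Rightarrow> 'a::euclidean_space set \<Rightarrow> (('a \<Rightarrow> real) \<Rightarrow> real) \<Rightarrow> real" where
  "X0_dual_norm s \<Omega> F = (SUP v\<in>{v \<in> X0 s \<Omega>. X0_norm s v \<le> 1}. \<bar>F v\<bar>)"

section \<open>Bochner spaces and the distributional time derivative\<close>

abbreviation time_measure :: "real \<Rightarrow> real measure" where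
  "time_measure T \<equiv> lebesgue_on {0<..<T}"

text \<open>
  The spaces above depend on \<open>\<Omega>\<close> and \<open>s\<close> and hence are not types, so strong measurability
  (being almost everywhere the limit in norm of simple functions) is stated relative to a carrier
  set \<open>V\<close> and a norm \<open>nrm\<close> on it. The difference is the pointwise difference of functions.
\<close>

definition strongly_measurable_in ::
    "'b::minus set \<Rightarrow> ('b \<Rightarrow> real) \<Rightarrow> 't measure \<Rightarrow> ('t \<Rightarrow> 'b) \<Rightarrow> bool" where
  "strongly_measurable_in V nrm M u \<longleftrightarrow>
     (\<exists>F :: nat \<Rightarrow> 't \<Rightarrow> 'b.
        (\<forall>n. simple_function M (F n) \<and> F n ` space M \<subseteq> V) \<and>
        (AE t in M. u t \<in> V \<and> (\<lambda>n. nrm (F n t - u t)) \<longlonglongrightarrow> 0))"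

definition bochner_L2 ::
    "'b::minus set \<Rightarrow> ('b \<Rightarrow> real) \<Rightarrow> 't measure \<Rightarrow> ('t \<Rightarrow> 'b) set" where
  "bochner_L2 V nrm M =
     {u. strongly_measurable_in V nrm M u \<and> integrable M (\<lambda>t. (nrm (u t))\<^sup>2)}"

definition L2_X0 ::
    "real \<Rightarrow> 'a::euclidean_space set \<Rightarrow> real \<Rightarrow> (real \<Rightarrow> 'a \<Rightarrow> real) set" where
  "L2_X0 s \<Omega> T = bochner_L2 (X0 s \<Omega>) (X0_norm s) (time_measure T)"

definition L2_X0_dual ::
    "real \<Rightarrow> 'a::euclidean_space set \<Rightarrow> real \<Rightarrow> (real \<Rightarrow> ('a \<Rightarrow> real) \<Rightarrow> real) set" where
  "L2_X0_dual s \<Omega> T = bochner_L2 (X0_dual s \<Omega>) (X0_dual_norm s \<Omega>) (time_measure T)"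

definition test_fun :: "real \<Rightarrow> (real \<Rightarrow> real) \<Rightarrow> bool" where
  "test_fun T \<phi> \<longleftrightarrow>
     (\<forall>n t. (deriv ^^ n) \<phi> field_differentiable (at t)) \<and> closure {t. \<phi> t \<noteq> 0} \<subseteq> {0<..<T}"

definition is_time_deriv ::
    "real \<Rightarrow> 'a::euclidean_space set \<Rightarrow> real \<Rightarrow> (real \<Rightarrow> 'a \<Rightarrow> real) \<Rightarrow>
     (real \<Rightarrow> ('a \<Rightarrow> real) \<Rightarrow> real) \<Rightarrow> bool" where
  "is_time_deriv s \<Omega> T u u' \<longleftrightarrow>
     u' \<in> L2_X0_dual s \<Omega> T \<and>
     (\<forall>v\<in>X0 s \<Omega>. \<forall>\<phi>. test_fun T \<phi> \<longrightarrow>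
        (LINT t|time_measure T. u' t v * \<phi> t) =
        - (LINT t|time_measure T. (LINT x|lebesgue_on \<Omega>. u t x * v x) * deriv \<phi> t))"

section \<open>Finite energy solutions\<close>

text \<open>
  The initial condition refers to a version of \<open>u\<close> modified on a null set of times, as an element
  of a Bochner space has no well-defined values at individual times.
\<close>

definition zero_initial ::
    "'a::euclidean_space set \<Rightarrow> real \<Rightarrow> (real \<Rightarrow> 'a \<Rightarrow> real) \<Rightarrow> bool" where
  "zero_initial \<Omega> T u \<longleftrightarrow>
     (\<exists>w. (AE t in time_measure T. AE x in lebesgue_on \<Omega>. w t x = u t x) \<and>
          (\<forall>t\<in>{0<..<T}. L2_fun \<Omega> (w t)) \<and>
          ((\<lambda>t. L2_norm_on \<Omega> (w t)) \<longlongrightarrow> 0) (at_right 0))"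

definition reaction :: "real \<Rightarrow> real \<Rightarrow> real" where
  "reaction \<alpha> r = \<bar>r\<bar> powr (\<alpha> - 1) * r"

text \<open>
  Absolute convergence of the right-hand side is part of the definition, since a divergent
  integral is \<open>0\<close> in HOL. The integral over \<open>(0,T) \<times> \<Omega>\<close> is taken as an iterated one: the
  functions \<open>u t\<close> are chosen separately for each \<open>t\<close>, so \<open>u\<close> need not be jointly measurable.
\<close>

definition finite_energy_solution ::
    "real \<Rightarrow> 'a::euclidean_space set \<Rightarrow> real \<Rightarrow> real \<Rightarrow> ('a \<Rightarrow> real) \<Rightarrow>
     (real \<Rightarrow> 'a \<Rightarrow> real) \<Rightarrow> bool" where
  "finite_energy_solution s \<Omega> T \<alpha> q u \<longleftrightarrow>
     u \<in> L2_X0 s \<Omega> T \<and>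
     zero_initial \<Omega> T u \<and>
     (\<exists>u'. is_time_deriv s \<Omega> T u u' \<and>
        (\<forall>\<phi>\<in>L2_X0 s \<Omega> T.
           (AE t in time_measure T.
              integrable (lebesgue_on \<Omega>) (\<lambda>x. q x * reaction \<alpha> (u t x) * \<phi> t x)) \<and>
           integrable (time_measure T)
              (\<lambda>t. LINT x|lebesgue_on \<Omega>. \<bar>q x * reaction \<alpha> (u t x) * \<phi> t x\<bar>) \<and>
           (LINT t|time_measure T. u' t (\<phi> t)) + (LINT t|time_measure T. energy s (u t) (\<phi> t)) =
           (LINT t|time_measure T.
              LINT x|lebesgue_on \<Omega>. q x * reaction \<alpha> (u t x) * \<phi> t x)))"

definition ess_bounded ::
    "'a::euclidean_space set \<Rightarrow> real \<Rightarrow> (real \<Rightarrow> 'a \<Rightarrow> real) \<Rightarrow> bool" where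
  "ess_bounded \<Omega> T u \<longleftrightarrow>
     (\<exists>C. AE t in time_measure T. AE x in lebesgue_on \<Omega>. \<bar>u t x\<bar> \<le> C)"

end

theory Submission
  imports Defs
begin

text \<open>
  Uniqueness is a linear matter: where \<open>u\<close> is bounded (or \<open>\<alpha> = 1\<close>), the reaction term is
  \<open>f = q R(u)\<close> with \<open>R\<close> Lipschitz and \<open>R 0 = 0\<close>, so \<open>\<parallel>f(t)\<parallel> \<le> \<kappa> \<parallel>u(t)\<parallel>\<close> in \<open>L\<^sup>2(\<Omega>)\<close>.

  The usual argument multiplies the equation by \<open>u\<close> and needs the chain rule
  \<open>d/dt \<parallel>u\<parallel>\<^sup>2 = 2 \<langle>u\<^sub>t, u\<rangle>\<close>. It can be avoided, because the energy is symmetric. For a fixed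
  \<open>v\<close> in the energy space, testing with \<open>\<eta>(t) v\<close> eliminates the time derivative and shows that
  \<open>t \<mapsto> (u(t), v)\<close> has the weak derivative \<open>- E(u(t), v) + (f(t), v)\<close>. With the zero initial
  value, the lemma of du Bois-Reymond (\<open>weak_derivative_imp_primitive\<close>) gives, for almost every \<open>\<tau>\<close>,
  \<open>(u(\<tau>), v) = \<integral>\<^sub>0\<^sup>\<tau> - E(u(\<sigma>), v) + (f(\<sigma>), v) d\<sigma>\<close>. The null set of exceptional \<open>\<tau>\<close> may be chosen
  independently of \<open>v\<close> in the countable set of values of simple functions approximating \<open>u\<close>, and
  by \<open>fractional_Poincare\<close> both sides are continuous in \<open>v\<close> for the energy norm, so that
  \<open>v = u(\<tau>)\<close> is admissible. Integrating over \<open>\<tau> < c\<close>,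
  \<open>\<integral>\<^sub>0\<^sup>c \<parallel>u\<parallel>\<^sup>2 = - \<integral>\<integral> E(u(\<sigma>), u(\<tau>)) + \<integral>\<integral> (f(\<sigma>), u(\<tau>))\<close> over the triangle \<open>\<sigma> < \<tau> < c\<close>.
  By symmetry the first double integral is half of the one over the square, which is the energy of
  \<open>\<integral>\<^sub>0\<^sup>c u\<close> and hence nonnegative (\<open>energy_triangle_integral\<close>). What remains is
  \<open>\<integral>\<^sub>0\<^sup>c \<parallel>u\<parallel>\<^sup>2 \<le> \<kappa> (\<integral>\<^sub>0\<^sup>c \<parallel>u\<parallel>)\<^sup>2\<close>, and by the Cauchy-Schwarz inequality this forces \<open>u\<close> to vanish on
  successive intervals shorter than \<open>1 / \<kappa>\<close> (\<open>AE_zero_of_short_time_estimate\<close>).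
\<close>

section \<open>Square-integrable functions\<close>

definition square_integrable :: "'b measure \<Rightarrow> ('b \<Rightarrow> real) \<Rightarrow> bool" where
  "square_integrable M f \<longleftrightarrow> f \<in> borel_measurable M \<and> integrable M (\<lambda>x. (f x)\<^sup>2)"

definition norm2 :: "'b measure \<Rightarrow> ('b \<Rightarrow> real) \<Rightarrow> real" where
  "norm2 M f = sqrt (LINT x|M. (f x)\<^sup>2)"

lemma square_integrable_measurable [measurable_dest]:
  "square_integrable M f \<Longrightarrow> f \<in> borel_measurable M"
  by (simp add: square_integrable_def)

lemma norm2_nonneg [simp]: "0 \<le> norm2 M f"
  by (simp add: norm2_def)

lemma norm2_power2: "(norm2 M f)\<^sup>2 = (LINT x|M. (f x)\<^sup>2)"
  by (simp add: norm2_def)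

lemma integrable_mult_square_integrable:
  assumes "square_integrable M f" "square_integrable M g"
  shows "integrable M (\<lambda>x. f x * g x)"
proof (rule Bochner_Integration.integrable_bound)
  show "integrable M (\<lambda>x. (f x)\<^sup>2 + (g x)\<^sup>2)"
    using assms by (auto simp: square_integrable_def)
  show "(\<lambda>x. f x * g x) \<in> borel_measurable M"
    using assms[THEN square_integrable_measurable] by measurable
  have "\<bar>a * b\<bar> \<le> a\<^sup>2 + b\<^sup>2" for a b :: real
  proof -
    have "2 * \<bar>a * b\<bar> \<le> a\<^sup>2 + b\<^sup>2"
      using sum_squares_bound[of "\<bar>a\<bar>" "\<bar>b\<bar>"] by (simp add: abs_mult)
    then show ?thesis by simp
  qed
  then show "AE x in M. norm (f x * g x) \<le> norm ((f x)\<^sup>2 + (g x)\<^sup>2)"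
    by (auto simp del: abs_mult)
qed

lemma square_integrable_lincomb:
  assumes "square_integrable M f" "square_integrable M g"
  shows "square_integrable M (\<lambda>x. a * f x + b * g x)"
proof -
  have "integrable M (\<lambda>x. a\<^sup>2 * (f x)\<^sup>2 + 2 * a * b * (f x * g x) + b\<^sup>2 * (g x)\<^sup>2)"
    using assms integrable_mult_square_integrable[OF assms] by (auto simp: square_integrable_def)
  then have "integrable M (\<lambda>x. (a * f x + b * g x)\<^sup>2)"
    by (simp add: power2_eq_square algebra_simps)
  then show ?thesis
    using assms unfolding square_integrable_def by auto
qed

text \<open>The quadratic form \<open>(a, b) \<mapsto> \<integral>(a f + b g)\<^sup>2\<close> is nonnegative. Writing its coefficients as
  \<open>A\<close>, \<open>2B\<close>, \<open>C\<close>, its value at \<open>(C, -B)\<close> is \<open>C (A C - B\<^sup>2)\<close>; if \<open>C = 0\<close>, its value at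
  \<open>(B, -(A + 1))\<close> forces \<open>B = 0\<close>.\<close>

lemma Cauchy_Schwarz_integral:
  assumes f: "square_integrable M f" and g: "square_integrable M g"
  shows "\<bar>LINT x|M. f x * g x\<bar> \<le> norm2 M f * norm2 M g"
proof -
  define A B C where "A = (LINT x|M. (f x)\<^sup>2)" and "B = (LINT x|M. f x * g x)"
    and "C = (LINT x|M. (g x)\<^sup>2)"
  have int: "integrable M (\<lambda>x. (f x)\<^sup>2)" "integrable M (\<lambda>x. (g x)\<^sup>2)" "integrable M (\<lambda>x. f x * g x)"
    using f g integrable_mult_square_integrable[OF f g] by (auto simp: square_integrable_def)
  have poly: "0 \<le> a\<^sup>2 * A + 2 * a * b * B + b\<^sup>2 * C" for a b
  proof -
    have "0 \<le> (LINT x|M. (a * f x + b * g x)\<^sup>2)" by simp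
    also have "\<dots> = (LINT x|M. a\<^sup>2 * (f x)\<^sup>2 + 2 * a * b * (f x * g x) + b\<^sup>2 * (g x)\<^sup>2)"
      by (simp add: power2_eq_square algebra_simps)
    also have "\<dots> = a\<^sup>2 * A + 2 * a * b * B + b\<^sup>2 * C"
      using int by (simp add: A_def B_def C_def)
    finally show ?thesis .
  qed
  have nn: "0 \<le> A" "0 \<le> C" by (simp_all add: A_def C_def)
  have "B\<^sup>2 \<le> A * C"
  proof (cases "C = 0")
    case True
    have "0 \<le> B\<^sup>2 * A + 2 * B * (- (A + 1)) * B"
      using poly[of B "- (A + 1)"] True by simp
    also have "\<dots> = - (B\<^sup>2 * (A + 2))" by (simp add: power2_eq_square algebra_simps)
    finally have "B\<^sup>2 * (A + 2) \<le> 0" by simp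
    with nn have "B\<^sup>2 \<le> 0" by (smt (verit) mult_pos_pos zero_le_power2)
    then show ?thesis using True by simp
  next
    case False
    have "0 \<le> C\<^sup>2 * A + 2 * C * (- B) * B + B\<^sup>2 * C"
      using poly[of C "- B"] by simp
    also have "\<dots> = C * (A * C - B\<^sup>2)" by (simp add: power2_eq_square algebra_simps)
    finally show ?thesis using False nn by (simp add: zero_le_mult_iff)
  qed
  then have "\<bar>B\<bar> \<le> sqrt (A * C)"
    by (metis real_sqrt_abs real_sqrt_le_iff)
  then show ?thesis
    by (simp add: A_def B_def C_def norm2_def real_sqrt_mult)
qed

lemma norm2_triangle:
  assumes f: "square_integrable M f" and g: "square_integrable M g"
  shows "norm2 M (\<lambda>x. f x + g x) \<le> norm2 M f + norm2 M g"
proof -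
  have int: "integrable M (\<lambda>x. (f x)\<^sup>2)" "integrable M (\<lambda>x. (g x)\<^sup>2)" "integrable M (\<lambda>x. f x * g x)"
    using f g integrable_mult_square_integrable[OF f g] by (auto simp: square_integrable_def)
  have "(norm2 M (\<lambda>x. f x + g x))\<^sup>2 = (LINT x|M. (f x)\<^sup>2 + 2 * (f x * g x) + (g x)\<^sup>2)"
    unfolding norm2_power2 by (simp add: power2_eq_square algebra_simps)
  also have "\<dots> = (norm2 M f)\<^sup>2 + 2 * (LINT x|M. f x * g x) + (norm2 M g)\<^sup>2"
    using int by (simp add: norm2_power2)
  also have "\<dots> \<le> (norm2 M f)\<^sup>2 + 2 * (norm2 M f * norm2 M g) + (norm2 M g)\<^sup>2"
    using Cauchy_Schwarz_integral[OF f g] by linarith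
  also have "\<dots> = (norm2 M f + norm2 M g)\<^sup>2"
    by (simp add: power2_eq_square algebra_simps)
  finally show ?thesis
    by (rule power2_le_imp_le) simp
qed

lemma norm2_scale: "norm2 M (\<lambda>x. c * f x) = \<bar>c\<bar> * norm2 M f"
  by (simp add: norm2_def power_mult_distrib real_sqrt_mult)

lemma norm2_diff_commute: "norm2 M (\<lambda>x. f x - g x) = norm2 M (\<lambda>x. g x - f x)"
  by (simp add: norm2_def power2_commute)

lemma norm2_eq_0_iff:
  "square_integrable M f \<Longrightarrow> norm2 M f = 0 \<longleftrightarrow> (AE x in M. f x = 0)"
  using integral_nonneg_eq_0_iff_AE[of M "\<lambda>x. (f x)\<^sup>2"]
  by (simp add: norm2_def square_integrable_def)

lemma abs_integral_mult_diff_le: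
  assumes f: "square_integrable M f" and g: "square_integrable M g" and h: "square_integrable M h"
  shows "\<bar>(LINT x|M. f x * g x) - (LINT x|M. f x * h x)\<bar> \<le> norm2 M f * norm2 M (\<lambda>x. g x - h x)"
proof -
  have "(LINT x|M. f x * g x) - (LINT x|M. f x * h x) = (LINT x|M. f x * (g x - h x))"
    using integrable_mult_square_integrable[OF f] g h by (simp add: right_diff_distrib)
  then show ?thesis
    using Cauchy_Schwarz_integral[OF f, of "\<lambda>x. g x - h x"] square_integrable_lincomb[OF g h, of 1 "-1"]
    by simp
qed

lemma square_integrable_dominated:
  assumes f: "f \<in> borel_measurable M" and g: "square_integrable M g" and c: "0 \<le> c"
    and le: "AE x in M. \<bar>f x\<bar> \<le> c * \<bar>g x\<bar>"
  shows "square_integrable M f" and "norm2 M f \<le> c * norm2 M g"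
proof -
  have sq: "AE x in M. (f x)\<^sup>2 \<le> c\<^sup>2 * (g x)\<^sup>2"
    using le
  proof eventually_elim
    case (elim x)
    then have "\<bar>f x\<bar>\<^sup>2 \<le> (c * \<bar>g x\<bar>)\<^sup>2" by (rule power_mono) simp
    then show ?case by (simp add: power_mult_distrib)
  qed
  have gi: "integrable M (\<lambda>x. c\<^sup>2 * (g x)\<^sup>2)" using g by (simp add: square_integrable_def)
  have fi: "integrable M (\<lambda>x. (f x)\<^sup>2)"
    by (rule Bochner_Integration.integrable_bound[OF gi]) (use f sq in simp_all)
  then show "square_integrable M f" using f by (simp add: square_integrable_def)
  have "(LINT x|M. (f x)\<^sup>2) \<le> (LINT x|M. c\<^sup>2 * (g x)\<^sup>2)"
    by (rule integral_mono_AE[OF fi gi sq])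
  then have "(norm2 M f)\<^sup>2 \<le> (c * norm2 M g)\<^sup>2"
    by (simp add: norm2_power2 power_mult_distrib)
  then show "norm2 M f \<le> c * norm2 M g"
    by (rule power2_le_imp_le) (simp add: c)
qed

lemma norm2_triangle_diff:
  assumes f: "square_integrable M f" and g: "square_integrable M g"
  shows "\<bar>norm2 M f - norm2 M g\<bar> \<le> norm2 M (\<lambda>x. f x - g x)"
proof -
  have *: "norm2 M f \<le> norm2 M g + norm2 M (\<lambda>x. f x - g x)"
    if f: "square_integrable M f" and g: "square_integrable M g" for f g
    using norm2_triangle[OF g, of "\<lambda>x. f x - g x"] square_integrable_lincomb[OF f g, of 1 "-1"] by simp
  show ?thesis using *[OF f g] *[OF g f] norm2_diff_commute[of M f g] by (simp add: abs_le_iff)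
qed

lemma square_integrable_lebesgue_on:
  assumes "square_integrable lebesgue f" "S \<in> sets lebesgue"
  shows "square_integrable (lebesgue_on S) f"
  using assms integrable_mult_indicator[of S lebesgue "\<lambda>x. (f x)\<^sup>2"]
  by (simp add: square_integrable_def measurable_restrict_space1 integrable_restrict_space)

section \<open>The energy space\<close>

text \<open>With this half of the kernel, the energy is an inner product in \<open>L\<^sup>2\<close> of the product space.\<close>

definition frac_diff :: "real \<Rightarrow> ('a::euclidean_space \<Rightarrow> real) \<Rightarrow> 'a \<times> 'a \<Rightarrow> real" where
  "frac_diff s u = (\<lambda>(x, y). (u x - u y) / norm (x - y) powr ((real DIM('a) + 2 * s) / 2))"

lemma frac_kernel_eq: "frac_kernel s u v z = frac_diff s u z * frac_diff s v z"
  for u :: "'a::euclidean_space \<Rightarrow> real"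
proof -
  define p where "p = (real DIM('a) + 2 * s) / 2"
  have "norm (x - y) powr (real DIM('a) + 2 * s) = norm (x - y) powr p * norm (x - y) powr p" for x y :: 'a
    by (simp add: powr_add[symmetric] p_def)
  then show ?thesis
    by (simp add: frac_kernel_def frac_diff_def split_beta p_def[symmetric])
qed

text \<open>The projections are measurable for the completed measures because the preimage of a null set
  is a null cylinder.\<close>

lemma lebesgue_measurable_fst_snd:
  fixes u :: "'a::euclidean_space \<Rightarrow> real"
  assumes u: "u \<in> borel_measurable lebesgue"
  shows "(\<lambda>z. u (fst z)) \<in> borel_measurable (lebesgue :: ('a \<times> 'a) measure)"
    and "(\<lambda>z. u (snd z)) \<in> borel_measurable (lebesgue :: ('a \<times> 'a) measure)"
proof -
  have *: "p \<in> (lebesgue :: ('a \<times> 'a) measure) \<rightarrow>\<^sub>M (lebesgue :: 'a measure)"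
    if p: "p \<in> borel_measurable borel" and e: "\<And>N. N \<in> sets borel \<Longrightarrow> emeasure lborel N = 0 \<Longrightarrow>
      emeasure lborel (p -` N) = 0" for p :: "'a \<times> 'a \<Rightarrow> 'a"
  proof (rule completion.measurable_completion2)
    show "p \<in> lebesgue \<rightarrow>\<^sub>M lborel" using p by (simp add: measurable_completion)
    show "null_sets lborel \<subseteq> null_sets (distr lebesgue lborel p)"
    proof
      fix N assume "N \<in> null_sets (lborel :: 'a measure)"
      then have N: "N \<in> sets borel" "emeasure lborel N = 0" by auto
      have m: "p -` N \<in> sets borel" using measurable_sets[OF p N(1)] by simp
      have "emeasure (distr lebesgue lborel p) N = emeasure lborel (p -` N)"
        using p N m by (subst emeasure_distr) (auto simp: measurable_completion)
      then show "N \<in> null_sets (distr lebesgue lborel p)"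
        using e[OF N] N by auto
    qed
  qed
  have "fst \<in> (lebesgue :: ('a \<times> 'a) measure) \<rightarrow>\<^sub>M (lebesgue :: 'a measure)"
  proof (rule *)
    fix N :: "'a set" assume "N \<in> sets borel" "emeasure lborel N = 0"
    then show "emeasure lborel (fst -` N :: ('a \<times> 'a) set) = 0"
      using lborel.emeasure_pair_measure_Times[of N lborel UNIV]
      by (simp add: lborel_prod vimage_fst)
  qed (simp add: borel_measurable_continuous_onI continuous_on_fst)
  then show "(\<lambda>z. u (fst z)) \<in> borel_measurable (lebesgue :: ('a \<times> 'a) measure)"
    by (rule measurable_compose[OF _ u])
  have "snd \<in> (lebesgue :: ('a \<times> 'a) measure) \<rightarrow>\<^sub>M (lebesgue :: 'a measure)"
  proof (rule *)
    fix N :: "'a set" assume "N \<in> sets borel" "emeasure lborel N = 0"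
    then show "emeasure lborel (snd -` N :: ('a \<times> 'a) set) = 0"
      using lborel.emeasure_pair_measure_Times[of UNIV lborel N]
      by (simp add: lborel_prod vimage_snd)
  qed (simp add: borel_measurable_continuous_onI continuous_on_snd)
  then show "(\<lambda>z. u (snd z)) \<in> borel_measurable (lebesgue :: ('a \<times> 'a) measure)"
    by (rule measurable_compose[OF _ u])
qed

lemma frac_diff_measurable:
  fixes u :: "'a::euclidean_space \<Rightarrow> real"
  assumes u: "u \<in> borel_measurable lebesgue"
  shows "frac_diff s u \<in> borel_measurable lebesgue"
proof -
  have "(\<lambda>z :: 'a \<times> 'a. norm (fst z - snd z) powr ((real DIM('a) + 2 * s) / 2)) \<in> borel_measurable borel"
    by (intro powr_real_measurable borel_measurable_const borel_measurable_continuous_onI continuous_intros)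
  then have "(\<lambda>z :: 'a \<times> 'a. norm (fst z - snd z) powr ((real DIM('a) + 2 * s) / 2)) \<in> borel_measurable lebesgue"
    by (simp add: measurable_completion)
  then show ?thesis
    using lebesgue_measurable_fst_snd[OF u] unfolding frac_diff_def split_beta
    by (intro borel_measurable_divide borel_measurable_diff)
qed

lemma X0_iff:
  "u \<in> X0 s \<Omega> \<longleftrightarrow> square_integrable lebesgue u \<and> square_integrable lebesgue (frac_diff s u) \<and>
     (AE x in lebesgue. x \<notin> \<Omega> \<longrightarrow> u x = 0)"
proof -
  have "frac_kernel s u u = (\<lambda>z. (frac_diff s u z)\<^sup>2)"
    by (auto simp: frac_kernel_eq power2_eq_square)
  then show ?thesis
    using frac_diff_measurable[of u s]
    by (auto simp: X0_def Hs_space_def L2_fun_def square_integrable_def lebesgue_on_UNIV_eq)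
qed

lemma X0_lincomb:
  assumes "u \<in> X0 s \<Omega>" "v \<in> X0 s \<Omega>"
  shows "(\<lambda>x. a * u x + b * v x) \<in> X0 s \<Omega>"
proof -
  have "frac_diff s (\<lambda>x. a * u x + b * v x) = (\<lambda>z. a * frac_diff s u z + b * frac_diff s v z)"
    by (auto simp: frac_diff_def fun_eq_iff diff_divide_distrib[symmetric] add_divide_distrib[symmetric]
      algebra_simps)
  moreover have "AE x in lebesgue. x \<notin> \<Omega> \<longrightarrow> a * u x + b * v x = 0"
  proof -
    have "AE x in lebesgue. x \<notin> \<Omega> \<longrightarrow> u x = 0" "AE x in lebesgue. x \<notin> \<Omega> \<longrightarrow> v x = 0"
      using assms by (auto simp: X0_iff)
    then show ?thesis by eventually_elim auto
  qed
  ultimately show ?thesis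
    using assms by (auto simp: X0_iff square_integrable_lincomb)
qed

lemma X0_zero: "(\<lambda>x. 0) \<in> X0 s \<Omega>"
  by (simp add: X0_iff square_integrable_def frac_diff_def split_beta)

lemma X0_diff: "u \<in> X0 s \<Omega> \<Longrightarrow> v \<in> X0 s \<Omega> \<Longrightarrow> (\<lambda>x. u x - v x) \<in> X0 s \<Omega>"
  using X0_lincomb[of u s \<Omega> v 1 "-1"] by simp

lemma X0_scale: "u \<in> X0 s \<Omega> \<Longrightarrow> (\<lambda>x. c * u x) \<in> X0 s \<Omega>"
  using X0_lincomb[of u s \<Omega> u c 0] by simp

lemma frac_const_pos:
  assumes "0 < s" "s < 1"
  shows "0 < frac_const N s"
  using assms unfolding frac_const_def
  by (intro divide_pos_pos mult_pos_pos Gamma_real_pos) auto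

lemma energy_eq:
  "energy s u v = frac_const DIM('a) s / 2 * (LINT z|lebesgue. frac_diff s u z * frac_diff s v z)"
  for u :: "'a::euclidean_space \<Rightarrow> real"
  by (simp add: energy_def frac_kernel_eq)

lemma X0_norm_eq:
  "X0_norm s u = sqrt (frac_const DIM('a) s / 2) * norm2 lebesgue (frac_diff s u)"
  for u :: "'a::euclidean_space \<Rightarrow> real"
  by (simp add: X0_norm_def energy_eq norm2_def power2_eq_square real_sqrt_mult[symmetric])

lemma energy_commute: "energy s u v = energy s v u"
  by (simp add: energy_eq mult.commute)

lemma frac_diff_diff: "frac_diff s (\<lambda>x. u x - v x) = (\<lambda>z. frac_diff s u z - frac_diff s v z)"
  by (auto simp: frac_diff_def fun_eq_iff diff_divide_distrib[symmetric] algebra_simps)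

lemma frac_diff_scale: "frac_diff s (\<lambda>x. c * u x) = (\<lambda>z. c * frac_diff s u z)"
  by (auto simp: frac_diff_def fun_eq_iff right_diff_distrib)

lemma energy_scale_right: "energy s u (\<lambda>x. c * v x) = c * energy s u v"
  by (simp add: energy_eq frac_diff_scale mult.left_commute)

lemma energy_zero [simp]: "energy s (\<lambda>x. 0) v = 0" "energy s v (\<lambda>x. 0) = 0"
  by (simp_all add: energy_eq frac_diff_def split_beta)

lemma X0_norm_scale: "X0_norm s (\<lambda>x. c * v x) = \<bar>c\<bar> * X0_norm s v"
  by (simp add: X0_norm_eq frac_diff_scale norm2_scale)

lemma X0_norm_zero [simp]: "X0_norm s (\<lambda>x. 0) = 0"
  by (simp add: X0_norm_def)

lemma X0_norm_diff_commute: "X0_norm s (\<lambda>x. u x - v x) = X0_norm s (\<lambda>x. v x - u x)"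
  by (simp add: X0_norm_eq frac_diff_diff norm2_diff_commute[of _ "frac_diff s u"])

context
  fixes s :: real and \<Omega> :: "'a::euclidean_space set"
  assumes s: "0 < s" "s < 1"
begin

lemma X0_norm_nonneg: "0 \<le> X0_norm s (u :: 'a \<Rightarrow> real)"
  using frac_const_pos[OF s, of "DIM('a)"] by (simp add: X0_norm_eq)

lemma abs_energy_le:
  assumes "u \<in> X0 s \<Omega>" "v \<in> X0 s \<Omega>"
  shows "\<bar>energy s u v\<bar> \<le> X0_norm s u * X0_norm s v"
proof -
  have c: "0 < frac_const DIM('a) s" by (rule frac_const_pos[OF s])
  have "\<bar>energy s u v\<bar> = frac_const DIM('a) s / 2 * \<bar>LINT z|lebesgue. frac_diff s u z * frac_diff s v z\<bar>"
    using c by (simp add: energy_eq abs_mult)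
  also have "\<dots> \<le> frac_const DIM('a) s / 2 * (norm2 lebesgue (frac_diff s u) * norm2 lebesgue (frac_diff s v))"
    using assms c by (intro mult_left_mono Cauchy_Schwarz_integral) (auto simp: X0_iff)
  also have "frac_const DIM('a) s / 2 = sqrt (frac_const DIM('a) s / 2) * sqrt (frac_const DIM('a) s / 2)"
    using c by simp
  finally show ?thesis
    unfolding X0_norm_eq by (simp only: mult_ac)
qed

lemma energy_diff_right:
  assumes "u \<in> X0 s \<Omega>" "v \<in> X0 s \<Omega>" "w \<in> X0 s \<Omega>"
  shows "energy s u (\<lambda>x. v x - w x) = energy s u v - energy s u w"
proof -
  have "integrable lebesgue (\<lambda>z. frac_diff s u z * frac_diff s v z)"
    "integrable lebesgue (\<lambda>z. frac_diff s u z * frac_diff s w z)"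
    using assms by (auto simp: X0_iff intro: integrable_mult_square_integrable)
  then show ?thesis
    by (simp add: energy_eq frac_diff_diff right_diff_distrib)
qed

lemma energy_diff_left:
  assumes "u \<in> X0 s \<Omega>" "v \<in> X0 s \<Omega>" "w \<in> X0 s \<Omega>"
  shows "energy s (\<lambda>x. v x - w x) u = energy s v u - energy s w u"
  using energy_diff_right[OF assms] by (simp add: energy_commute)

lemma X0_norm_triangle_diff:
  assumes "u \<in> X0 s \<Omega>" "v \<in> X0 s \<Omega>"
  shows "\<bar>X0_norm s u - X0_norm s v\<bar> \<le> X0_norm s (\<lambda>x. u x - v x)"
proof -
  have *: "X0_norm s u - X0_norm s v \<le> X0_norm s (\<lambda>x. u x - v x)"
    if "u \<in> X0 s \<Omega>" "v \<in> X0 s \<Omega>" for u v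
  proof -
    have c: "0 < frac_const DIM('a) s" by (rule frac_const_pos[OF s])
    have "norm2 lebesgue (\<lambda>z. frac_diff s v z + frac_diff s (\<lambda>x. u x - v x) z)
        \<le> norm2 lebesgue (frac_diff s v) + norm2 lebesgue (frac_diff s (\<lambda>x. u x - v x))"
      using that X0_diff[OF that] by (intro norm2_triangle) (auto simp: X0_iff)
    then have "norm2 lebesgue (frac_diff s u)
        \<le> norm2 lebesgue (frac_diff s v) + norm2 lebesgue (frac_diff s (\<lambda>x. u x - v x))"
      by (simp add: frac_diff_diff)
    then show ?thesis
      using c by (simp add: X0_norm_eq flip: right_diff_distrib)
  qed
  show ?thesis
    using *[OF assms] *[OF assms(2,1)] X0_norm_diff_commute[of s u v] by (simp add: abs_le_iff)
qed

text \<open>This is the energy of \<open>\<Sum>v\<in>S. m v \<cdot> v\<close>, written without forming the sum of functions. For the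
  values \<open>S\<close> of a simple function of time and the measures \<open>m\<close> of its level sets, it is the double
  time integral of the energy.\<close>

lemma energy_Gram_nonneg:
  assumes "finite S" "S \<subseteq> X0 s \<Omega>"
  shows "0 \<le> (\<Sum>v\<in>S. \<Sum>w\<in>S. m v * m w * energy s v w)"
proof -
  have int: "integrable lebesgue (\<lambda>z. m v * m w * (frac_diff s v z * frac_diff s w z))"
    if "v \<in> S" "w \<in> S" for v w
    using assms that by (intro integrable_mult_right integrable_mult_square_integrable) (auto simp: X0_iff)
  have "0 \<le> frac_const DIM('a) s / 2 * (LINT z|lebesgue. (\<Sum>v\<in>S. m v * frac_diff s v z)\<^sup>2)"
    using frac_const_pos[OF s, of "DIM('a)"] by simp
  also have "\<dots> = frac_const DIM('a) s / 2 *
      (LINT z|lebesgue. (\<Sum>v\<in>S. \<Sum>w\<in>S. m v * m w * (frac_diff s v z * frac_diff s w z)))"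
    by (simp add: power2_eq_square sum_product mult_ac)
  also have "\<dots> = (\<Sum>v\<in>S. \<Sum>w\<in>S. m v * m w * energy s v w)"
    using int by (simp add: energy_eq sum_distrib_left mult_ac)
  finally show ?thesis .
qed

end

lemma AE_lebesgue_fst_snd:
  fixes P :: "'a::euclidean_space \<Rightarrow> bool"
  assumes "AE x in lebesgue. P x"
  shows "AE z in (lebesgue :: ('a \<times> 'a) measure). P (fst z)"
    and "AE z in (lebesgue :: ('a \<times> 'a) measure). P (snd z)"
proof -
  have "AE x in lborel. P x"
    using assms by (simp add: AE_completion_iff)
  then obtain N where N: "{x. \<not> P x} \<subseteq> N" "N \<in> sets borel" "emeasure lborel N = 0"
    using AE_E[of P lborel] by (metis (no_types, lifting) Collect_cong UNIV_I sets_lborel space_borel space_lborel)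
  have 1: "N \<times> UNIV \<in> null_sets (lborel :: ('a \<times> 'a) measure)"
  proof (rule null_setsI)
    show "emeasure lborel (N \<times> (UNIV :: 'a set)) = 0"
      using N lborel.emeasure_pair_measure_Times[of N lborel UNIV] by (simp add: lborel_prod)
    show "N \<times> (UNIV :: 'a set) \<in> sets lborel"
      using N by (simp add: borel_Times)
  qed
  have 2: "UNIV \<times> N \<in> null_sets (lborel :: ('a \<times> 'a) measure)"
  proof (rule null_setsI)
    show "emeasure lborel ((UNIV :: 'a set) \<times> N) = 0"
      using N lborel.emeasure_pair_measure_Times[of UNIV lborel N] by (simp add: lborel_prod)
    show "(UNIV :: 'a set) \<times> N \<in> sets lborel"
      using N by (simp add: borel_Times)
  qed
  show "AE z in (lebesgue :: ('a \<times> 'a) measure). P (fst z)"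
    by (rule AE_completion, rule AE_I'[OF 1]) (use N in auto)
  show "AE z in (lebesgue :: ('a \<times> 'a) measure). P (snd z)"
    by (rule AE_completion, rule AE_I'[OF 2]) (use N in auto)
qed

lemma nn_integral_lebesgue_tensor_indicator:
  fixes W :: "'a::euclidean_space \<Rightarrow> real"
  assumes W: "W \<in> borel_measurable lebesgue" and B: "B \<in> sets borel"
  shows "(\<integral>\<^sup>+z. ennreal (W (fst z)) * indicator B (snd z) \<partial>(lebesgue :: ('a \<times> 'a) measure)) =
    (\<integral>\<^sup>+x. ennreal (W x) \<partial>lebesgue) * emeasure lborel B"
proof -
  obtain W' where W': "W' \<in> borel_measurable lborel" "AE x in lborel. W x = W' x"
    using completion_ex_borel_measurable_real[OF W] by blast
  have [measurable]: "W' \<in> borel_measurable borel" using W' by simp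
  have [measurable]: "B \<in> sets borel" by fact
  have eq: "AE x in lebesgue. W x = W' x" using W'(2) by (rule AE_completion)
  have "(\<integral>\<^sup>+z. ennreal (W (fst z)) * indicator B (snd z) \<partial>(lebesgue :: ('a \<times> 'a) measure))
      = (\<integral>\<^sup>+z. ennreal (W' (fst z)) * indicator B (snd z) \<partial>(lebesgue :: ('a \<times> 'a) measure))"
    using AE_lebesgue_fst_snd(1)[OF eq] by (intro nn_integral_cong_AE) auto
  also have "\<dots> = (\<integral>\<^sup>+z. ennreal (W' (fst z)) * indicator B (snd z) \<partial>(lborel \<Otimes>\<^sub>M lborel))"
    by (simp add: lborel_prod nn_integral_completion)
  also have "\<dots> = (\<integral>\<^sup>+x. \<integral>\<^sup>+y. ennreal (W' x) * indicator B y \<partial>lborel \<partial>lborel)"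
    by (subst lborel.nn_integral_fst[symmetric]) auto
  also have "\<dots> = (\<integral>\<^sup>+x. ennreal (W' x) * emeasure lborel B \<partial>lborel)"
    by (simp add: nn_integral_cmult)
  also have "\<dots> = (\<integral>\<^sup>+x. ennreal (W' x) \<partial>lborel) * emeasure lborel B"
    by (simp add: nn_integral_multc)
  also have "(\<integral>\<^sup>+x. ennreal (W' x) \<partial>lborel) = (\<integral>\<^sup>+x. ennreal (W x) \<partial>lebesgue)"
    using W'(2) by (simp add: nn_integral_completion, intro nn_integral_cong_AE) auto
  finally show ?thesis .
qed

text \<open>Comparing the values of \<open>v\<close> on the bounded set \<open>\<Omega>\<close> with the value \<open>0\<close> on a ball disjoint
  from \<open>\<Omega>\<close> already gives a multiple of \<open>\<integral>v\<^sup>2\<close>, since the kernel is bounded below on the product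
  of the two sets.\<close>

lemma fractional_Poincare:
  fixes \<Omega> :: "'a::euclidean_space set"
  assumes s: "0 < s" "s < 1" and bnd: "bounded \<Omega>" and meas: "\<Omega> \<in> sets lebesgue"
  obtains P where "0 < P" "\<And>v. v \<in> X0 s \<Omega> \<Longrightarrow> norm2 (lebesgue_on \<Omega>) v \<le> P * X0_norm s v"
proof -
  obtain R where R: "0 < R" "\<And>x. x \<in> \<Omega> \<Longrightarrow> norm x \<le> R"
    using bnd by (auto simp: bounded_pos)
  obtain e :: 'a where e: "norm e = R + 2"
    using vector_choose_size[of "R + 2"] R by auto
  \<comment> \<open>A unit ball at distance at least \<open>1\<close> from a ball of radius \<open>R\<close> that contains \<open>\<Omega>\<close>.\<close>
  define B where "B = ball e 1"
  define p where "p = real DIM('a) + 2 * s"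
  define d where "d = 2 * R + 3"
  define \<kappa> where "\<kappa> = measure lborel B / d powr p"
  have d: "0 < d" using R by (simp add: d_def)
  have p: "0 < p" using s by (simp add: p_def)
  have Bpos: "0 < measure lborel B"
    unfolding B_def using content_ball_pos[of 1 e] by (simp add: measure_completion)
  have emB: "emeasure lborel B = ennreal (measure lborel B)"
    using emeasure_lborel_ball_finite[of e 1] unfolding B_def by (intro emeasure_eq_ennreal_measure) auto
  have \<kappa>: "0 < \<kappa>" using Bpos d by (simp add: \<kappa>_def)
  have B_far: "y \<notin> \<Omega> \<and> 0 < norm (x - y) \<and> norm (x - y) \<le> d" if "x \<in> \<Omega>" "y \<in> B" for x y
  proof -
    have 1: "norm (e - y) < 1" using that by (simp add: B_def dist_norm)
    have 2: "norm e \<le> norm (e - y) + norm y" "norm y \<le> norm (e - y) + norm e"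
      using norm_triangle_ineq[of "e - y" y] norm_triangle_ineq[of "y - e" e]
      by (simp_all add: norm_minus_commute)
    have 3: "norm (x - y) \<le> norm x + norm y" "norm y \<le> norm (x - y) + norm x"
      using norm_triangle_ineq4[of x y] norm_triangle_ineq[of "y - x" x]
      by (simp_all add: norm_minus_commute)
    show ?thesis using 1 2 3 R(2)[OF \<open>x \<in> \<Omega>\<close>] R(2)[of y] e by (auto simp: d_def)
  qed
  have key: "\<kappa> * (norm2 (lebesgue_on \<Omega>) v)\<^sup>2 \<le> (norm2 lebesgue (frac_diff s v))\<^sup>2" if v: "v \<in> X0 s \<Omega>" for v
  proof -
    define W where "W = (\<lambda>x. indicator \<Omega> x * (v x)\<^sup>2)"
    have vsq: "square_integrable lebesgue v" "square_integrable lebesgue (frac_diff s v)"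
      and v0: "AE x in lebesgue. x \<notin> \<Omega> \<longrightarrow> v x = 0"
      using v by (auto simp: X0_iff)
    have Wint: "integrable lebesgue W"
      using vsq(1) meas integrable_mult_indicator[of \<Omega> lebesgue "\<lambda>x. (v x)\<^sup>2"]
      by (simp add: W_def square_integrable_def)
    have W_LINT: "(LINT x|lebesgue. W x) = (norm2 (lebesgue_on \<Omega>) v)\<^sup>2"
      unfolding norm2_power2 W_def using meas by (simp add: integral_restrict_space)
    have le: "AE z in (lebesgue :: ('a \<times> 'a) measure).
        (1 / d powr p) * (W (fst z) * indicator B (snd z)) \<le> (frac_diff s v z)\<^sup>2"
      using AE_lebesgue_fst_snd(2)[OF v0]
    proof eventually_elim
      fix z :: "'a \<times> 'a" assume z: "snd z \<notin> \<Omega> \<longrightarrow> v (snd z) = 0"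
      show "(1 / d powr p) * (W (fst z) * indicator B (snd z)) \<le> (frac_diff s v z)\<^sup>2"
      proof (cases "fst z \<in> \<Omega> \<and> snd z \<in> B")
        case True
        define x y where "x = fst z" and "y = snd z"
        have xy: "0 < norm (x - y)" "norm (x - y) \<le> d" "v y = 0"
          using True B_far[of x y] z by (auto simp: x_def y_def)
        have "(frac_diff s v z)\<^sup>2 = (v x)\<^sup>2 / norm (x - y) powr p"
          using xy by (simp add: frac_diff_def split_beta x_def[symmetric] y_def[symmetric] power_divide
            power2_eq_square p_def powr_add[symmetric])
        moreover have "norm (x - y) powr p \<le> d powr p"
          using xy p by (intro powr_mono2) auto
        ultimately show ?thesis
          using True xy d by (simp add: W_def x_def[symmetric] divide_left_mono)
      qed (auto simp: W_def)
    qed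
    have "ennreal (1 / d powr p) * (ennreal (LINT x|lebesgue. W x) * emeasure lborel B)
        = ennreal (1 / d powr p) * (\<integral>\<^sup>+z. ennreal (W (fst z)) * indicator B (snd z) \<partial>(lebesgue :: ('a \<times> 'a) measure))"
      using Wint by (subst nn_integral_lebesgue_tensor_indicator) (auto simp: B_def nn_integral_eq_integral W_def)
    also have "\<dots> = (\<integral>\<^sup>+z. ennreal ((1 / d powr p) * (W (fst z) * indicator B (snd z))) \<partial>(lebesgue :: ('a \<times> 'a) measure))"
    proof (subst nn_integral_cmult[symmetric])
      have "indicator B \<in> borel_measurable (borel :: 'a measure)"
        by (intro borel_measurable_indicator) (simp add: B_def)
      then have "(\<lambda>z. indicator B (snd z) :: ennreal) \<in> borel_measurable (borel :: ('a \<times> 'a) measure)"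
        by (rule measurable_compose[rotated]) (simp add: borel_measurable_continuous_onI continuous_on_snd)
      then have "(\<lambda>z. indicator B (snd z) :: ennreal) \<in> borel_measurable (lebesgue :: ('a \<times> 'a) measure)"
        by (simp add: measurable_completion)
      then show "(\<lambda>z. ennreal (W (fst z)) * indicator B (snd z)) \<in> borel_measurable (lebesgue :: ('a \<times> 'a) measure)"
        using lebesgue_measurable_fst_snd(1)[OF borel_measurable_integrable[OF Wint]] by simp
    next
      have "ennreal (1 / d powr p) * (ennreal (W (fst z)) * indicator B (snd z))
          = ennreal ((1 / d powr p) * (W (fst z) * indicator B (snd z)))" for z :: "'a \<times> 'a"
      proof (cases "snd z \<in> B")
        case True
        then show ?thesis using ennreal_mult'[of "1 / d powr p" "W (fst z)"] by simp
      qed simp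
      then show "(\<integral>\<^sup>+z. ennreal (1 / d powr p) * (ennreal (W (fst z)) * indicator B (snd z)) \<partial>lebesgue)
          = (\<integral>\<^sup>+z. ennreal ((1 / d powr p) * (W (fst z) * indicator B (snd z))) \<partial>(lebesgue :: ('a \<times> 'a) measure))"
        by (simp only:)
    qed
    also have "\<dots> \<le> (\<integral>\<^sup>+z. ennreal ((frac_diff s v z)\<^sup>2) \<partial>lebesgue)"
      using le by (intro nn_integral_mono_AE) (auto simp: ennreal_leI)
    also have "\<dots> = ennreal ((norm2 lebesgue (frac_diff s v))\<^sup>2)"
      using vsq(2) by (simp add: nn_integral_eq_integral square_integrable_def norm2_power2)
    finally have "ennreal (1 / d powr p * ((norm2 (lebesgue_on \<Omega>) v)\<^sup>2 * measure lborel B))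
        \<le> ennreal ((norm2 lebesgue (frac_diff s v))\<^sup>2)"
      unfolding W_LINT emB using d by (simp add: ennreal_mult'[symmetric])
    then show ?thesis
      by (simp add: \<kappa>_def mult_ac)
  qed
  define c where "c = sqrt (frac_const DIM('a) s / 2)"
  have c: "0 < c" using frac_const_pos[OF s] by (simp add: c_def)
  show thesis
  proof (rule that)
    show "0 < 1 / (sqrt \<kappa> * c)" using c \<kappa> by simp
    fix v assume v: "v \<in> X0 s \<Omega>"
    have "sqrt (\<kappa> * (norm2 (lebesgue_on \<Omega>) v)\<^sup>2) \<le> norm2 lebesgue (frac_diff s v)"
      using real_le_lsqrt[OF _ key[OF v]] by simp
    then have "sqrt \<kappa> * norm2 (lebesgue_on \<Omega>) v \<le> norm2 lebesgue (frac_diff s v)"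
      by (simp add: real_sqrt_mult)
    then have "norm2 (lebesgue_on \<Omega>) v \<le> norm2 lebesgue (frac_diff s v) / sqrt \<kappa>"
      using \<kappa> by (simp add: field_simps)
    also have "\<dots> = 1 / (sqrt \<kappa> * c) * X0_norm s v"
      using c by (simp add: X0_norm_eq c_def[symmetric])
    finally show "norm2 (lebesgue_on \<Omega>) v \<le> 1 / (sqrt \<kappa> * c) * X0_norm s v" .
  qed
qed

section \<open>Smooth test functions and weak derivatives\<close>

text \<open>The building block of bump functions, \<open>p(1/x) exp(-1/x)\<close> at \<open>x = c t + d\<close>, extended by \<open>0\<close> to
  \<open>x \<le> 0\<close>. The polynomial makes the family closed under differentiation.\<close>

definition flat_exp :: "real poly \<Rightarrow> real \<Rightarrow> real \<Rightarrow> real \<Rightarrow> real" where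
  "flat_exp p c d t = (if 0 < c * t + d then poly p (1 / (c * t + d)) * exp (- 1 / (c * t + d)) else 0)"

text \<open>A class of functions that is closed under differentiation by construction; its members are
  therefore infinitely differentiable, and no Leibniz formula for higher derivatives is needed.\<close>

inductive smooth_gen :: "(real \<Rightarrow> real) \<Rightarrow> bool" where
  base: "smooth_gen (flat_exp p c d)"
| scale: "smooth_gen f \<Longrightarrow> smooth_gen (\<lambda>t. k * f t)"
| add: "smooth_gen f \<Longrightarrow> smooth_gen g \<Longrightarrow> smooth_gen (\<lambda>t. f t + g t)"
| mult: "smooth_gen f \<Longrightarrow> smooth_gen g \<Longrightarrow> smooth_gen (\<lambda>t. f t * g t)"

lemma tendsto_poly_mult_exp_minus: "((\<lambda>y. poly p y * exp (- y)) \<longlongrightarrow> 0) at_top" for p :: "real poly"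
proof -
  have "((\<lambda>y. \<Sum>i\<le>degree p. coeff p i * (y ^ i / exp y)) \<longlongrightarrow> (\<Sum>i\<le>degree p. coeff p i * 0)) at_top"
    by (intro tendsto_sum tendsto_mult_left tendsto_power_div_exp_0)
  then show ?thesis
    by (simp add: poly_altdef sum_distrib_right exp_minus divide_inverse mult.assoc)
qed

text \<open>At \<open>x = 0\<close> the difference quotient from the right is \<open>y p(y) exp(-y)\<close> with \<open>y = 1/x\<close>, and the
  exponential beats every polynomial.\<close>

lemma flat_exp_unit_has_derivative:
  "(flat_exp p 1 0 has_real_derivative flat_exp (monom 1 2 * (p - pderiv p)) 1 0 x) (at x)"
proof -
  consider "x > 0" | "x < 0" | "x = 0" by linarith
  then show ?thesis
  proof cases
    case 1
    have inv: "((\<lambda>t. 1 / t) has_real_derivative - (1 / x\<^sup>2)) (at x)"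
      using 1 by (auto intro!: derivative_eq_intros simp: power2_eq_square)
    have "((\<lambda>t. poly p (1 / t) * exp (- (1 / t))) has_real_derivative
        poly (pderiv p) (1 / x) * - (1 / x\<^sup>2) * exp (- (1 / x)) +
        exp (- (1 / x)) * (- (- (1 / x\<^sup>2))) * poly p (1 / x)) (at x)"
      by (rule DERIV_mult[OF DERIV_chain'[OF inv poly_DERIV]
        DERIV_fun_exp[OF DERIV_minus[OF inv]]])
    moreover have "poly (pderiv p) (1 / x) * - (1 / x\<^sup>2) * exp (- (1 / x)) +
        exp (- (1 / x)) * (- (- (1 / x\<^sup>2))) * poly p (1 / x) =
        poly (monom 1 2 * (p - pderiv p)) (1 / x) * exp (- 1 / x)"
      by (simp add: poly_monom power_divide algebra_simps)
    ultimately have "((\<lambda>t. poly p (1 / t) * exp (- 1 / t)) has_real_derivative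
        poly (monom 1 2 * (p - pderiv p)) (1 / x) * exp (- 1 / x)) (at x)"
      by simp
    then have "((\<lambda>t. poly p (1 / t) * exp (- 1 / t)) has_real_derivative
        flat_exp (monom 1 2 * (p - pderiv p)) 1 0 x) (at x)"
      using 1 by (simp add: flat_exp_def)
    then show ?thesis
      by (rule has_field_derivative_transform_within_open[of _ _ _ "{0<..}"]) (use 1 in \<open>auto simp: flat_exp_def\<close>)
  next
    case 2
    have "((\<lambda>t. 0) has_real_derivative flat_exp (monom 1 2 * (p - pderiv p)) 1 0 x) (at x)"
      using 2 by (simp add: flat_exp_def)
    then show ?thesis
      by (rule has_field_derivative_transform_within_open[of _ _ _ "{..<0}"]) (use 2 in \<open>auto simp: flat_exp_def\<close>)
  next
    case 3
    have "((\<lambda>y. flat_exp p 1 0 y / y) \<longlongrightarrow> 0) (at 0)"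
    proof (rule filterlim_split_at)
      have "((\<lambda>y. poly (monom 1 1 * p) (inverse y) * exp (- inverse y)) \<longlongrightarrow> 0) (at_right 0)"
        by (rule filterlim_compose[OF tendsto_poly_mult_exp_minus filterlim_inverse_at_top_right])
      then show "((\<lambda>y. flat_exp p 1 0 y / y) \<longlongrightarrow> 0) (at_right 0)"
        by (rule Lim_transform_eventually)
          (auto simp: eventually_at_filter flat_exp_def poly_monom divide_inverse mult_ac)
      show "((\<lambda>y. flat_exp p 1 0 y / y) \<longlongrightarrow> 0) (at_left 0)"
        by (rule tendsto_eventually) (auto simp: eventually_at_filter flat_exp_def)
    qed
    then show ?thesis
      using 3 by (simp add: has_field_derivative_iff flat_exp_def)
  qed
qed

lemma flat_exp_has_derivative:
  "(flat_exp p c d has_real_derivative flat_exp (smult c (monom 1 2 * (p - pderiv p))) c d x) (at x)"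
proof -
  have eq: "flat_exp p c d = (\<lambda>t. flat_exp p 1 0 (c * t + d))"
    by (auto simp: flat_exp_def)
  have "((\<lambda>t. c * t + d) has_real_derivative c) (at x)"
    by (auto intro!: derivative_eq_intros)
  from DERIV_chain'[OF this flat_exp_unit_has_derivative[of p]]
  moreover have "flat_exp (smult c (monom 1 2 * (p - pderiv p))) c d x =
      c * flat_exp (monom 1 2 * (p - pderiv p)) 1 0 (c * x + d)"
    by (simp add: flat_exp_def)
  ultimately show ?thesis unfolding eq by (simp add: mult.commute)
qed

lemma smooth_gen_has_derivative:
  "smooth_gen f \<Longrightarrow> \<exists>f'. smooth_gen f' \<and> (\<forall>t. (f has_real_derivative f' t) (at t))"
proof (induction rule: smooth_gen.induct)
  case (base p c d)
  then show ?case using flat_exp_has_derivative smooth_gen.base by blast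
next
  case (scale f k)
  then obtain f' where "smooth_gen f'" "\<And>t. (f has_real_derivative f' t) (at t)" by blast
  then show ?case
    by (intro exI[of _ "\<lambda>t. k * f' t"]) (auto intro: DERIV_cmult smooth_gen.scale)
next
  case (add f g)
  then obtain f' g' where *: "smooth_gen f'" "smooth_gen g'"
    "\<And>t. (f has_real_derivative f' t) (at t)" "\<And>t. (g has_real_derivative g' t) (at t)" by blast
  then show ?case
    by (intro exI[of _ "\<lambda>t. f' t + g' t"]) (auto intro: DERIV_add smooth_gen.add)
next
  case (mult f g)
  then obtain f' g' where *: "smooth_gen f'" "smooth_gen g'"
    "\<And>t. (f has_real_derivative f' t) (at t)" "\<And>t. (g has_real_derivative g' t) (at t)" by blast
  have "((\<lambda>t. f t * g t) has_real_derivative f' t * g t + g' t * f t) (at t)" for t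
    by (rule DERIV_mult[OF *(3,4)])
  moreover have "smooth_gen (\<lambda>t. f' t * g t + g' t * f t)"
    using * mult.hyps by (intro smooth_gen.intros)
  ultimately show ?case by blast
qed

lemma smooth_gen_deriv_funpow: "smooth_gen f \<Longrightarrow> smooth_gen ((deriv ^^ n) f)"
proof (induction n arbitrary: f)
  case (Suc n)
  from smooth_gen_has_derivative[OF Suc.prems] obtain f' where f': "smooth_gen f'"
    "\<forall>t. (f has_real_derivative f' t) (at t)" by blast
  then have "deriv f = f'" by (auto intro!: DERIV_imp_deriv)
  with Suc.IH[OF f'(1)] show ?case by (simp add: funpow_swap1)
qed simp

lemma smooth_gen_differentiable: "smooth_gen f \<Longrightarrow> (deriv ^^ n) f field_differentiable (at t)"
  using smooth_gen_has_derivative[OF smooth_gen_deriv_funpow, of f n]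
  by (auto simp: field_differentiable_def)

lemma smooth_gen_continuous: "smooth_gen f \<Longrightarrow> continuous_on A f"
proof -
  assume "smooth_gen f"
  then obtain f' where "\<forall>t. (f has_real_derivative f' t) (at t)"
    using smooth_gen_has_derivative by blast
  then show ?thesis
    by (auto intro!: continuous_at_imp_continuous_on DERIV_isCont)
qed

lemma integrable_time_measure_continuous:
  fixes f :: "real \<Rightarrow> real"
  assumes "continuous_on {0..T} f"
  shows "integrable (time_measure T) f"
proof -
  have "f absolutely_integrable_on {0..T}"
    using assms by (rule absolutely_integrable_continuous_real)
  then have "f absolutely_integrable_on {0<..<T}"
    by (rule set_integrable_subset) auto
  then show ?thesis
    by (simp add: absolutely_integrable_on_iff_nonneg integrable_restrict_space set_integrable_def)
qed

lemma integral_time_measure: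
  fixes f :: "real \<Rightarrow> real"
  assumes "continuous_on {0..T} f"
  shows "(LINT t|time_measure T. f t) = integral {0..T} f"
  using lebesgue_integral_eq_integral[OF integrable_time_measure_continuous[OF assms]]
  by (simp add: integral_open_interval_real)

lemma test_fun_primitive:
  assumes \<psi>: "smooth_gen \<psi>" and ab: "0 < a" "a \<le> b" "b < T"
    and supp: "\<And>t. t \<notin> {a..b} \<Longrightarrow> \<psi> t = 0"
    and zero: "(LINT t|time_measure T. \<psi> t) = 0"
  obtains \<eta> where "test_fun T \<eta>" "deriv \<eta> = \<psi>"
proof
  define \<eta> where "\<eta> = (\<lambda>t. integral {0..t} \<psi>)"
  note cont = smooth_gen_continuous[OF \<psi>]
  have left: "\<eta> t = 0" if "t \<le> a" for t
  proof -
    have *: "\<psi> s = 0" if "s \<in> {0..t} - {a}" for s using that \<open>t \<le> a\<close> supp[of s] by simp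
    have "(\<psi> has_integral 0) {0..t}"
      by (rule has_integral_spike_finite[OF _ _ has_integral_0, of "{a}"]) (simp_all add: *)
    then show ?thesis unfolding \<eta>_def by (rule integral_unique)
  qed
  have right: "\<eta> t = 0" if "t \<ge> b" for t
  proof -
    have van: "integral {r..r'} \<psi> = 0" if "b \<le> r" for r r'
    proof -
      have *: "\<psi> s = 0" if "s \<in> {r..r'} - {b}" for s using that \<open>b \<le> r\<close> supp[of s] by simp
      have "(\<psi> has_integral 0) {r..r'}"
        by (rule has_integral_spike_finite[OF _ _ has_integral_0, of "{b}"]) (simp_all add: *)
      then show ?thesis by (rule integral_unique)
    qed
    have int: "\<psi> integrable_on {0..r}" for r by (intro integrable_continuous_real cont)
    have "integral {0..r} \<psi> = integral {0..b} \<psi>" if "b \<le> r" for r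
      using Henstock_Kurzweil_Integration.integral_combine[OF _ that int, of ] ab van[OF order_refl, of r] by simp
    from this[OF that] this[of T] ab zero show ?thesis
      unfolding integral_time_measure[OF cont] by (simp add: \<eta>_def)
  qed
  have deriv: "(\<eta> has_real_derivative \<psi> t) (at t)" for t
  proof (cases "t < a")
    case True
    have "((\<lambda>_. 0) has_real_derivative \<psi> t) (at t)" using True supp[of t] by simp
    then show ?thesis
      by (rule has_field_derivative_transform_within_open[of _ _ _ "{..<a}"]) (use True left in auto)
  next
    case False
    then have "(\<eta> has_real_derivative \<psi> t) (at t within {0..t + 1})"
      unfolding \<eta>_def using ab by (intro integral_has_real_derivative cont) auto
    then show ?thesis
      using False ab by (simp add: at_within_Icc_at)
  qed
  then show d: "deriv \<eta> = \<psi>" by (auto intro!: DERIV_imp_deriv)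
  have "(deriv ^^ n) \<eta> field_differentiable at t" for n t
  proof (cases n)
    case 0
    then show ?thesis using deriv by (auto simp: field_differentiable_def)
  next
    case (Suc m)
    then show ?thesis using smooth_gen_differentiable[OF \<psi>, of m t] d by (simp add: funpow_swap1)
  qed
  moreover have "closure {t. \<eta> t \<noteq> 0} \<subseteq> {a..b}"
  proof (rule closure_minimal)
    show "{t. \<eta> t \<noteq> 0} \<subseteq> {a..b}"
    proof
      fix t assume "t \<in> {t. \<eta> t \<noteq> 0}"
      then have "\<not> t \<le> a" "\<not> b \<le> t" using left[of t] right[of t] by auto
      then show "t \<in> {a..b}" by simp
    qed
  qed auto
  moreover have "{a..b} \<subseteq> {0<..<T}" using ab by auto
  ultimately show "test_fun T \<eta>" unfolding test_fun_def by blast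
qed

text \<open>Supported in \<open>[x + 1/n, y - 1/n]\<close>, and converging boundedly to the indicator function of
  \<open>(x, y)\<close>: both arguments of \<open>exp\<close> tend to \<open>0\<close> inside the interval.\<close>

definition bump :: "nat \<Rightarrow> real \<Rightarrow> real \<Rightarrow> real \<Rightarrow> real" where
  "bump n x y t = flat_exp 1 (real n) (- (real n * x) - 1) t * flat_exp 1 (- real n) (real n * y - 1) t"

lemma smooth_gen_bump: "smooth_gen (bump n x y)"
  unfolding bump_def[abs_def] by (intro smooth_gen.intros)

lemma bump_bounds: "0 \<le> bump n x y t" "bump n x y t \<le> 1"
  by (auto simp: bump_def flat_exp_def intro!: mult_le_one)

lemma bump_support:
  assumes "t \<notin> {x + 1 / real n..y - 1 / real n}"
  shows "bump n x y t = 0"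
proof (cases "n = 0")
  case False
  then have "t < x + 1 / real n \<Longrightarrow> real n * t - real n * x < 1" "y - 1 / real n < t \<Longrightarrow> real n * y - real n * t < 1"
    by (simp_all add: field_simps)
  then show ?thesis using assms by (auto simp: bump_def flat_exp_def not_le)
qed (simp add: bump_def flat_exp_def)

lemma bump_tendsto:
  "(\<lambda>n. bump n x y t) \<longlonglongrightarrow> indicator {x<..<y} t"
proof (cases "t \<in> {x<..<y}")
  case True
  have *: "(\<lambda>n. flat_exp 1 (real n) (e * real n - 1) 0) \<longlonglongrightarrow> 1" if "0 < e" for e
  proof -
    have lim: "filterlim (\<lambda>n. e * real n - 1) at_top sequentially"
      using that by real_asymp
    have "(\<lambda>n. exp (- inverse (e * real n - 1))) \<longlonglongrightarrow> exp (- 0)"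
      by (intro tendsto_intros tendsto_inverse_0_at_top lim)
    moreover have "eventually (\<lambda>n. 0 < e * real n - 1) sequentially"
      using lim unfolding filterlim_at_top_dense by blast
    ultimately show ?thesis
      by (rule_tac Lim_transform_eventually) (auto elim!: eventually_mono simp: flat_exp_def divide_inverse)
  qed
  have "bump n x y t = flat_exp 1 (real n) ((t - x) * real n - 1) 0 * flat_exp 1 (real n) ((y - t) * real n - 1) 0" for n
    by (simp add: bump_def flat_exp_def algebra_simps)
  with tendsto_mult[OF *[of "t - x"] *[of "y - t"]] True show ?thesis by simp
next
  case False
  then have "bump n x y t = 0" for n
  proof (cases "n = 0")
    case n: False
    then show ?thesis using False bump_support[of t x n y]
      by (smt (verit) atLeastAtMost_iff greaterThanLessThan_iff of_nat_0_less_iff bot_nat_0.not_eq_extremum zero_less_divide_1_iff)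
  qed (simp add: bump_def flat_exp_def)
  then show ?thesis using False by simp
qed

text \<open>The positive and the negative part are densities of two finite measures that agree on all half
  lines, hence are equal.\<close>

lemma AE_zero_if_halfline_integrals_zero:
  fixes k :: "real \<Rightarrow> real"
  assumes k: "integrable lborel k"
    and zero: "\<And>x. (LINT t|lborel. indicator {x<..} t * k t) = 0"
  shows "AE t in lborel. k t = 0"
proof -
  define k1 k2 where "k1 t = max 0 (k t)" and "k2 t = max 0 (- k t)" for t
  have [measurable]: "k \<in> borel_measurable borel" using borel_measurable_integrable[OF k] by simp
  have int: "integrable lborel k1" "integrable lborel k2"
    unfolding k1_def[abs_def] k2_def[abs_def] using k by (auto intro!: integrable_max)
  have [measurable]: "k1 \<in> borel_measurable borel" "k2 \<in> borel_measurable borel"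
    unfolding k1_def[abs_def] k2_def[abs_def] by measurable
  have em: "emeasure (density lborel (\<lambda>t. ennreal (f t))) {x<..} = ennreal (LINT t|lborel. indicator {x<..} t * f t)"
    if "integrable lborel f" "\<And>t. 0 \<le> f t" "f \<in> borel_measurable borel" for f :: "real \<Rightarrow> real" and x
  proof -
    have "emeasure (density lborel (\<lambda>t. ennreal (f t))) {x<..} = (\<integral>\<^sup>+t. ennreal (f t) * indicator {x<..} t \<partial>lborel)"
      using that by (subst emeasure_density) auto
    also have "\<dots> = (\<integral>\<^sup>+t. ennreal (indicator {x<..} t * f t) \<partial>lborel)"
      by (intro nn_integral_cong) (auto split: split_indicator)
    also have "\<dots> = ennreal (LINT t|lborel. indicator {x<..} t * f t)"
      using that integrable_mult_indicator[of "{x<..}" lborel f] by (intro nn_integral_eq_integral) auto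
    finally show ?thesis .
  qed
  have "density lborel (\<lambda>t. ennreal (k1 t)) = density lborel (\<lambda>t. ennreal (k2 t))"
  proof (rule measure_eqI_lessThan)
    fix x
    have "(LINT t|lborel. indicator {x<..} t * k1 t) - (LINT t|lborel. indicator {x<..} t * k2 t)
        = (LINT t|lborel. indicator {x<..} t * k1 t - indicator {x<..} t * k2 t)"
      using int integrable_mult_indicator[of "{x<..}" lborel k1] integrable_mult_indicator[of "{x<..}" lborel k2]
      by simp
    also have "\<dots> = (LINT t|lborel. indicator {x<..} t * k t)"
      by (intro Bochner_Integration.integral_cong) (auto simp: k1_def k2_def split: split_indicator)
    finally show "emeasure (density lborel (\<lambda>t. ennreal (k1 t))) {x<..} = emeasure (density lborel (\<lambda>t. ennreal (k2 t))) {x<..}"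
      using em[of k1 x] em[of k2 x] int zero[of x] by (simp add: k1_def k2_def)
    show "emeasure (density lborel (\<lambda>t. ennreal (k1 t))) {x<..} < \<infinity>"
      using em[of k1 x] int by (simp add: k1_def)
  qed simp_all
  then have "AE t in lborel. ennreal (k1 t) = ennreal (k2 t)"
    by (intro sigma_finite_measure.density_unique[OF lborel.sigma_finite_measure_axioms]) auto
  then show ?thesis
    by eventually_elim (auto simp: k1_def k2_def max_def split: if_splits)
qed

lemma sets_time_measure_halfline: "{0<..<T} \<inter> {..<\<tau>} \<in> sets (time_measure T)"
  by (simp add: sets_restrict_space_iff)

lemma borel_measurable_time_measure:
  "f \<in> borel_measurable borel \<Longrightarrow> f \<in> borel_measurable (time_measure T)"
  by (intro measurable_restrict_space1 measurable_completion) simp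

lemma finite_measure_time_measure: "finite_measure (time_measure T)"
  by (intro finite_measure_lebesgue_on) simp

lemma pair_sigma_finite_time_measure: "pair_sigma_finite (time_measure T) (time_measure T)"
proof -
  interpret finite_measure "time_measure T" by (rule finite_measure_time_measure)
  show ?thesis by (intro pair_sigma_finite.intro sigma_finite_measure_axioms)
qed

lemma integrable_mult_continuous:
  fixes f \<psi> :: "real \<Rightarrow> real"
  assumes f: "integrable (time_measure T) f" and \<psi>: "continuous_on {0..T} \<psi>"
    and m: "\<psi> \<in> borel_measurable borel"
  shows "integrable (time_measure T) (\<lambda>t. f t * \<psi> t)"
proof -
  obtain D where D: "\<And>t. t \<in> {0..T} \<Longrightarrow> \<bar>\<psi> t\<bar> \<le> D"
    using compact_imp_bounded[OF compact_continuous_image[OF \<psi> compact_Icc]]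
    unfolding bounded_iff by (metis imageI real_norm_def)
  show ?thesis
  proof (rule Bochner_Integration.integrable_bound)
    show "integrable (time_measure T) (\<lambda>t. f t * D)" using f by simp
    show "(\<lambda>t. f t * \<psi> t) \<in> borel_measurable (time_measure T)"
      using borel_measurable_time_measure[OF m] f by simp
    show "AE t in time_measure T. norm (f t * \<psi> t) \<le> norm (f t * D)"
    proof (rule AE_I2)
      fix t assume "t \<in> space (time_measure T)"
      then have "\<bar>\<psi> t\<bar> \<le> \<bar>D\<bar>" using D[of t] by simp
      then show "norm (f t * \<psi> t) \<le> norm (f t * D)" by (simp add: abs_mult mult_left_mono)
    qed
  qed
qed

text \<open>Integration by parts against a primitive, as an instance of Fubini's theorem on the
  triangle \<open>\<sigma> < \<tau>\<close>.\<close>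

lemma integral_primitive_mult_deriv:
  assumes T: "0 < T" and b: "integrable (time_measure T) b" and \<phi>: "test_fun T \<phi>"
  shows "(LINT \<tau>|time_measure T. (LINT \<sigma>|time_measure T. indicator {..<\<tau>} \<sigma> * b \<sigma>) * deriv \<phi> \<tau>)
    = - (LINT \<sigma>|time_measure T. b \<sigma> * \<phi> \<sigma>)"
proof -
  let ?M = "time_measure T"
  interpret pair_sigma_finite ?M ?M by (rule pair_sigma_finite_time_measure)
  have d1: "(\<phi> has_real_derivative deriv \<phi> t) (at t)" for t
    using \<phi> unfolding test_fun_def by (metis DERIV_deriv_iff_field_differentiable funpow_0)
  have d2: "deriv \<phi> field_differentiable at t" for t
    using \<phi> unfolding test_fun_def by (metis One_nat_def funpow_0 funpow_simps_right(2) funpow.simps(2) comp_apply)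
  have cont: "continuous_on A (deriv \<phi>)" for A
    using d2 by (intro continuous_at_imp_continuous_on) (auto intro: field_differentiable_imp_continuous_at)
  have \<phi>T: "\<phi> T = 0"
    using \<phi> closure_subset[of "{t. \<phi> t \<noteq> 0}"] unfolding test_fun_def by force
  obtain D where D: "\<And>t. t \<in> {0..T} \<Longrightarrow> \<bar>deriv \<phi> t\<bar> \<le> D"
    using compact_imp_bounded[OF compact_continuous_image[OF cont[of "{0..T}"] compact_Icc]]
    unfolding bounded_iff by (metis imageI real_norm_def)
  have D0: "0 \<le> D" using D[of 0] T by simp
  have mb: "b \<in> borel_measurable ?M" using b by simp
  have md: "deriv \<phi> \<in> borel_measurable ?M"
    by (intro borel_measurable_time_measure borel_measurable_continuous_onI cont)
  have idm: "(\<lambda>t. t) \<in> borel_measurable ?M" by (intro borel_measurable_time_measure) simp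
  have inn: "(LINT \<tau>|?M. indicator {\<sigma><..} \<tau> * deriv \<phi> \<tau>) = - \<phi> \<sigma>" if "\<sigma> \<in> {0<..<T}" for \<sigma>
  proof -
    have "(LINT \<tau>|?M. indicator {\<sigma><..} \<tau> * deriv \<phi> \<tau>) = (LINT \<tau>|lebesgue. indicator {\<sigma><..<T} \<tau> * deriv \<phi> \<tau>)"
      using that by (subst integral_restrict_space) (auto intro!: Bochner_Integration.integral_cong split: split_indicator)
    also have "\<dots> = (LINT \<tau>|lebesgue_on {\<sigma><..<T}. deriv \<phi> \<tau>)"
      by (subst integral_restrict_space) auto
    also have "\<dots> = integral {\<sigma><..<T} (deriv \<phi>)"
    proof (rule lebesgue_integral_eq_integral)
      have "deriv \<phi> absolutely_integrable_on {\<sigma>..T}"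
        by (intro absolutely_integrable_continuous_real cont)
      then have "deriv \<phi> absolutely_integrable_on {\<sigma><..<T}"
        by (rule set_integrable_subset) auto
      then show "integrable (lebesgue_on {\<sigma><..<T}) (deriv \<phi>)"
        by (simp add: integrable_restrict_space set_integrable_def)
    qed simp
    also have "\<dots> = integral {\<sigma>..T} (deriv \<phi>)" by (simp add: integral_open_interval_real)
    also have "\<dots> = \<phi> T - \<phi> \<sigma>"
      using that d1 by (intro integral_unique fundamental_theorem_of_calculus)
        (auto simp: has_real_derivative_iff_has_vector_derivative[symmetric] has_field_derivative_at_within)
    finally show ?thesis using \<phi>T by simp
  qed
  define f where "f z = indicator {z. fst z < snd z} (z :: real \<times> real) * (b (fst z) * deriv \<phi> (snd z))" for z
  have fst_snd: "fst \<in> ?M \<Otimes>\<^sub>M ?M \<rightarrow>\<^sub>M ?M" "snd \<in> ?M \<Otimes>\<^sub>M ?M \<rightarrow>\<^sub>M ?M" by simp_all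
  have mf: "f \<in> borel_measurable (?M \<Otimes>\<^sub>M ?M)"
  proof -
    have "{z \<in> space (?M \<Otimes>\<^sub>M ?M). fst z < snd z} \<in> sets (?M \<Otimes>\<^sub>M ?M)"
      using measurable_compose[OF fst_snd(1) idm] measurable_compose[OF fst_snd(2) idm] by measurable
    moreover have "(\<lambda>z. b (fst z) * deriv \<phi> (snd z)) \<in> borel_measurable (?M \<Otimes>\<^sub>M ?M)"
      using measurable_compose[OF fst_snd(1) mb] measurable_compose[OF fst_snd(2) md] by measurable
    moreover have "indicat_real {z. fst z < snd z} \<in> borel_measurable (?M \<Otimes>\<^sub>M ?M)"
      using calculation(1) by (subst borel_measurable_indicator_iff) (auto simp: Int_def conj_commute)
    ultimately show ?thesis unfolding f_def[abs_def] by measurable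
  qed
  have int: "integrable (?M \<Otimes>\<^sub>M ?M) f"
  proof (rule Bochner_Integration.integrable_bound[OF _ mf])
    show "integrable (?M \<Otimes>\<^sub>M ?M) (\<lambda>z. b (fst z) * D)"
    proof (intro integrable_mult_left)
      have "integrable (?M \<Otimes>\<^sub>M ?M) (\<lambda>z. b (fst z))"
      proof (rule Fubini_integrable)
        show "(\<lambda>z. b (fst z)) \<in> borel_measurable (?M \<Otimes>\<^sub>M ?M)" by (rule measurable_compose[OF fst_snd(1) mb])
      qed (use b finite_measure.integrable_const[OF finite_measure_time_measure] in auto)
      then show "integrable (?M \<Otimes>\<^sub>M ?M) (\<lambda>z. b (fst z))" .
    qed
    show "AE z in ?M \<Otimes>\<^sub>M ?M. norm (f z) \<le> norm (b (fst z) * D)"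
    proof (rule AE_I2)
      fix z assume "z \<in> space (?M \<Otimes>\<^sub>M ?M)"
      then have "\<bar>deriv \<phi> (snd z)\<bar> \<le> \<bar>D\<bar>"
        using D[of "snd z"] D0 by (auto simp: space_pair_measure)
      then show "norm (f z) \<le> norm (b (fst z) * D)"
        by (auto simp: f_def abs_mult mult_left_mono split: split_indicator)
    qed
  qed
  have "(LINT \<tau>|?M. (LINT \<sigma>|?M. indicator {..<\<tau>} \<sigma> * b \<sigma>) * deriv \<phi> \<tau>) = (LINT \<tau>|?M. LINT \<sigma>|?M. f (\<sigma>, \<tau>))"
    by (simp flip: Bochner_Integration.integral_mult_left_zero, intro Bochner_Integration.integral_cong refl)
      (auto simp: f_def split: split_indicator)
  also have "\<dots> = (LINT \<sigma>|?M. LINT \<tau>|?M. f (\<sigma>, \<tau>))"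
    using Fubini_integral[of "\<lambda>\<sigma> \<tau>. f (\<sigma>, \<tau>)"] int by simp
  also have "\<dots> = (LINT \<sigma>|?M. b \<sigma> * (LINT \<tau>|?M. indicator {\<sigma><..} \<tau> * deriv \<phi> \<tau>))"
    by (simp flip: Bochner_Integration.integral_mult_right_zero, intro Bochner_Integration.integral_cong refl)
      (auto simp: f_def split: split_indicator)
  also have "\<dots> = (LINT \<sigma>|?M. - (b \<sigma> * \<phi> \<sigma>))"
    using inn by (intro Bochner_Integration.integral_cong) auto
  finally show ?thesis by simp
qed


text \<open>The fundamental lemma of du Bois-Reymond, for a function that vanishes at time \<open>0\<close>: testing
  with primitives of \<open>R \<psi> - (\<integral>\<psi>) \<rho>\<close>, where \<open>\<rho>\<close> is one fixed bump with \<open>R = \<integral>\<rho>\<close>, and letting \<open>\<psi>\<close>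
  tend to the indicator function of \<open>(x, T)\<close> shows that \<open>g\<close> minus a primitive of \<open>b\<close> is constant.
  The initial condition makes the constant vanish.\<close>

lemma weak_derivative_imp_primitive:
  assumes T: "0 < T" and g: "integrable (time_measure T) g" and b: "integrable (time_measure T) b"
    and weak: "\<And>\<phi>. test_fun T \<phi> \<Longrightarrow>
      (LINT t|time_measure T. b t * \<phi> t) = - (LINT t|time_measure T. g t * deriv \<phi> t)"
    and init: "\<And>\<epsilon>. 0 < \<epsilon> \<Longrightarrow> \<exists>\<delta>>0. AE t in time_measure T. t < \<delta> \<longrightarrow> \<bar>g t\<bar> \<le> \<epsilon>"
  shows "AE \<tau> in time_measure T. g \<tau> = (LINT \<sigma>|time_measure T. indicator {..<\<tau>} \<sigma> * b \<sigma>)"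
proof -
  let ?M = "time_measure T"
  interpret finite_measure ?M by (rule finite_measure_time_measure)
  interpret pair_sigma_finite ?M ?M by (rule pair_sigma_finite_time_measure)
  define B where "B \<tau> = (LINT \<sigma>|?M. indicator {..<\<tau>} \<sigma> * b \<sigma>)" for \<tau>
  define h where "h \<tau> = g \<tau> - B \<tau>" for \<tau>
  have idm: "(\<lambda>t. t) \<in> borel_measurable ?M" by (intro borel_measurable_time_measure) simp
  have mb: "b \<in> borel_measurable ?M" using b by simp
  have mB: "B \<in> borel_measurable ?M"
  proof -
    have fst_snd: "fst \<in> ?M \<Otimes>\<^sub>M ?M \<rightarrow>\<^sub>M ?M" "snd \<in> ?M \<Otimes>\<^sub>M ?M \<rightarrow>\<^sub>M ?M" by simp_all
    have "{z \<in> space (?M \<Otimes>\<^sub>M ?M). snd z < fst z} \<in> sets (?M \<Otimes>\<^sub>M ?M)"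
      using measurable_compose[OF fst_snd(1) idm] measurable_compose[OF fst_snd(2) idm] by measurable
    then have "indicat_real {z. snd z < fst z} \<in> borel_measurable (?M \<Otimes>\<^sub>M ?M)"
      by (subst borel_measurable_indicator_iff) (auto simp: Int_def conj_commute)
    then have "(\<lambda>z. indicat_real {z. snd z < fst z} z * b (snd z)) \<in> borel_measurable (?M \<Otimes>\<^sub>M ?M)"
      using measurable_compose[OF fst_snd(2) mb] by measurable
    then have "case_prod (\<lambda>\<tau> \<sigma>. indicat_real {z. snd z < fst z} (\<tau>, \<sigma>) * b \<sigma>) \<in> borel_measurable (?M \<Otimes>\<^sub>M ?M)"
      by (simp add: split_beta')
    from sigma_finite_measure.borel_measurable_lebesgue_integral[OF finite_measure.axioms(1)[OF finite_measure_time_measure] this]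
    have "(\<lambda>\<tau>. LINT \<sigma>|?M. indicat_real {z. snd z < fst z} (\<tau>, \<sigma>) * b \<sigma>) \<in> borel_measurable ?M" .
    then show ?thesis
      by (simp add: B_def[abs_def] indicator_def)
  qed
  have B_le: "\<bar>B \<tau>\<bar> \<le> (LINT \<sigma>|?M. \<bar>b \<sigma>\<bar>)" for \<tau>
  proof -
    have "\<bar>B \<tau>\<bar> \<le> (LINT \<sigma>|?M. \<bar>indicator {..<\<tau>} \<sigma> * b \<sigma>\<bar>)"
      unfolding B_def by (rule integral_abs_bound)
    also have "\<dots> \<le> (LINT \<sigma>|?M. \<bar>b \<sigma>\<bar>)"
      using b by (intro integral_mono') (auto split: split_indicator)
    finally show ?thesis .
  qed
  have intB: "integrable ?M B"
    by (rule integrable_const_bound[OF _ mB]) (use B_le in auto)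
  have inth: "integrable ?M h" unfolding h_def[abs_def] using g intB by simp
  have cont_int: "integrable ?M (\<lambda>t. f t * \<psi> t)" if "integrable ?M f" "\<And>A. continuous_on A \<psi>" for f \<psi> :: "real \<Rightarrow> real"
    using that by (intro integrable_mult_continuous borel_measurable_continuous_onI)
  have h_test: "(LINT t|?M. h t * deriv \<phi> t) = 0" if \<phi>: "test_fun T \<phi>" and c: "\<And>A. continuous_on A (deriv \<phi>)" for \<phi>
  proof -
    have "(LINT t|?M. h t * deriv \<phi> t) = (LINT t|?M. g t * deriv \<phi> t) - (LINT t|?M. B t * deriv \<phi> t)"
      using cont_int[OF g c] cont_int[OF intB c] by (simp add: h_def left_diff_distrib)
    then show ?thesis
      using weak[OF \<phi>] integral_primitive_mult_deriv[OF T b \<phi>] by (simp add: B_def)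
  qed
  have bump_int: "integrable ?M (\<lambda>t. h t * bump n x T t)" "integrable ?M (bump n x T)" for n x
    using cont_int[OF inth] smooth_gen_continuous[OF smooth_gen_bump] integrable_time_measure_continuous by blast+
  have rel: "(LINT t|?M. bump m 0 T t) * (LINT t|?M. h t * bump n x T t) =
      (LINT t|?M. bump n x T t) * (LINT t|?M. h t * bump m 0 T t)" if x: "0 \<le> x" "x < T" for m n x
  proof -
    define R I where "R = (LINT t|?M. bump m 0 T t)" and "I = (LINT t|?M. bump n x T t)"
    define \<psi> where "\<psi> t = R * bump n x T t + (- I) * bump m 0 T t" for t
    have \<psi>: "smooth_gen \<psi>" unfolding \<psi>_def[abs_def] by (intro smooth_gen.intros smooth_gen_bump)
    have "(LINT t|?M. \<psi> t) = 0"
      unfolding \<psi>_def using bump_int by (simp add: R_def I_def)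
    show ?thesis
    proof (cases "m = 0 \<or> n = 0")
      case True
      then show ?thesis by (auto simp: bump_def flat_exp_def)
    next
      case False
      define e where "e = min (min (1 / real m) (1 / real n)) (T / 2)"
      have e: "0 < e" "e \<le> 1 / real m" "e \<le> 1 / real n" "e \<le> T / 2" using False T by (auto simp: e_def)
      have van: "\<psi> t = 0" if "t \<notin> {e..T - e}" for t
      proof -
        have "t \<notin> {x + 1 / real n..T - 1 / real n}" "t \<notin> {0 + 1 / real m..T - 1 / real m}"
          using that e x by auto
        then show ?thesis by (simp add: \<psi>_def bump_support)
      qed
      have eT: "e \<le> T - e" "T - e < T" using e by auto
      obtain \<eta> where \<eta>: "test_fun T \<eta>" "deriv \<eta> = \<psi>"
        using test_fun_primitive[OF \<psi> e(1) eT van \<open>(LINT t|?M. \<psi> t) = 0\<close>] by blast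
      have "0 = (LINT t|?M. h t * \<psi> t)"
        using h_test[OF \<eta>(1)] smooth_gen_continuous[OF \<psi>] \<eta>(2) by simp
      also have "\<dots> = (LINT t|?M. R * (h t * bump n x T t) - I * (h t * bump m 0 T t))"
        by (simp add: \<psi>_def algebra_simps)
      also have "\<dots> = R * (LINT t|?M. h t * bump n x T t) - I * (LINT t|?M. h t * bump m 0 T t)"
        using bump_int by simp
      finally show ?thesis by (simp add: R_def I_def)
    qed
  qed
  have lim: "(\<lambda>n. LINT t|?M. f t * bump n x T t) \<longlonglongrightarrow> (LINT t|?M. f t * indicator {x<..<T} t)"
    if f: "integrable ?M f" for f x
  proof (rule integral_dominated_convergence)
    show "integrable ?M (\<lambda>t. norm (f t))" using f by simp
    show "(\<lambda>t. f t * indicator {x<..<T} t) \<in> borel_measurable ?M"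
      using f borel_measurable_time_measure[of "indicat_real {x<..<T}" T] by simp
    show "(\<lambda>t. f t * bump n x T t) \<in> borel_measurable ?M" for n
      using f bump_int(2)[of n x] by simp
    show "AE t in ?M. (\<lambda>n. f t * bump n x T t) \<longlonglongrightarrow> f t * indicator {x<..<T} t"
      by (intro AE_I2 tendsto_intros bump_tendsto)
    show "AE t in ?M. norm (f t * bump n x T t) \<le> norm (f t)" for n
      using bump_bounds by (intro AE_I2) (simp add: abs_mult mult_left_le)
  qed
  have ind_int: "(LINT t|?M. indicator {x<..<T} t) = T - x" if "0 \<le> x" "x < T" for x
    using that by (subst integral_restrict_space) (auto simp: indicator_inter_arith[symmetric] Int_absorb1 Int_absorb2 measure_completion
      simp flip: indicator_inter_arith)
  have lim1: "(\<lambda>n. LINT t|?M. bump n x T t) \<longlonglongrightarrow> T - x" if "0 \<le> x" "x < T" for x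
    using lim[of "\<lambda>_. 1" x] ind_int[OF that] by simp
  obtain m where m: "0 < (LINT t|?M. bump m 0 T t)"
    using order_tendstoD(1)[OF lim1[of 0], of 0] T by (auto simp: eventually_sequentially)
  define \<kappa> where "\<kappa> = (LINT t|?M. h t * bump m 0 T t) / (LINT t|?M. bump m 0 T t)"
  have h_int: "(LINT t|?M. h t * indicator {x<..<T} t) = \<kappa> * (T - x)" if x: "0 \<le> x" "x < T" for x
  proof -
    have "(\<lambda>n. LINT t|?M. h t * bump n x T t) = (\<lambda>n. \<kappa> * (LINT t|?M. bump n x T t))"
      using rel[OF x, of m] m by (auto simp: \<kappa>_def field_simps)
    then have "(\<lambda>n. LINT t|?M. h t * bump n x T t) \<longlonglongrightarrow> \<kappa> * (T - x)"
      using tendsto_mult_left[OF lim1[OF x], of \<kappa>] by simp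
    then show ?thesis using lim[OF inth, of x] LIMSEQ_unique by blast
  qed
  have h_const: "AE t in ?M. h t = \<kappa>"
  proof -
    define k where "k t = indicator {0<..<T} t * (h t - \<kappa>)" for t
    have kint: "integrable lebesgue k"
      using inth integrable_restrict_space[of "{0<..<T}" lebesgue "\<lambda>t. h t - \<kappa>"]
      by (simp add: k_def[abs_def])
    obtain k' where k': "k' \<in> borel_measurable lborel" "AE t in lborel. k t = k' t"
      using completion_ex_borel_measurable_real[of k lborel] kint by auto
    have eq: "AE t in lebesgue. k t = k' t" using k'(2) by (rule AE_completion)
    have k'l: "k' \<in> borel_measurable lebesgue" using k'(1) by (simp add: measurable_completion)
    have k'int: "integrable lborel k'"
      using integrable_cong_AE_imp[OF kint k'l] eq integrable_completion[OF k'(1)] by (auto simp: eq_commute)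
    have "AE t in lborel. k' t = 0"
    proof (rule AE_zero_if_halfline_integrals_zero[OF k'int])
      fix x :: real
      have ind: "indicat_real {x<..} \<in> borel_measurable lebesgue"
        by (intro measurable_completion) simp
      have "(LINT t|lborel. indicator {x<..} t * k' t) = (LINT t|lebesgue. indicator {x<..} t * k' t)"
        using k'(1) by (subst integral_completion) auto
      also have "\<dots> = (LINT t|lebesgue. indicator {x<..} t * k t)"
        using eq k'l ind borel_measurable_integrable[OF kint] by (intro integral_cong_AE) auto
      also have "\<dots> = (LINT t|lebesgue. indicator {0<..<T} t * ((h t - \<kappa>) * indicator {max 0 x<..<T} t))"
        by (intro Bochner_Integration.integral_cong) (auto simp: k_def split: split_indicator)
      also have "\<dots> = (LINT t|?M. (h t - \<kappa>) * indicator {max 0 x<..<T} t)"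
        by (subst integral_restrict_space) auto
      also have "\<dots> = 0"
      proof (cases "x < T")
        case True
        have ii: "integrable ?M (\<lambda>t. h t * indicator {max 0 x<..<T} t)"
          using inth borel_measurable_time_measure[of "indicat_real {max 0 x<..<T}" T]
          by (intro Bochner_Integration.integrable_bound[OF inth]) (auto split: split_indicator)
        have i2: "integrable ?M (\<lambda>t. \<kappa> * indicator {max 0 x<..<T} t)"
          using borel_measurable_time_measure[of "indicat_real {max 0 x<..<T}" T]
          by (intro integrable_const_bound[of _ "\<bar>\<kappa>\<bar>"]) (auto split: split_indicator)
        show ?thesis
          using ii i2 h_int[of "max 0 x"] ind_int[of "max 0 x"] True T by (simp add: left_diff_distrib)
      qed simp
      finally show "(LINT t|lborel. indicator {x<..} t * k' t) = 0" .
    qed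
    with k'(2) have "AE t in lborel. k t = 0" by eventually_elim simp
    then have "AE t in lebesgue. k t = 0" by (rule AE_completion)
    then show ?thesis
      by (subst AE_restrict_space_iff) (auto simp: k_def indicator_def elim!: eventually_mono split: if_splits)
  qed
  \<comment> \<open>Almost every time is good, so there are good times tending to \<open>0\<close>; along them \<open>\<kappa> = g - B\<close> tends to \<open>0\<close>.\<close>
  have "\<exists>t\<in>{0<..<T}. t < 1 / real (Suc n) \<and> h t = \<kappa> \<and> \<bar>g t\<bar> \<le> 1 / real (Suc n)" for n
  proof (rule ccontr)
    assume neg: "\<not> ?thesis"
    obtain \<delta> where \<delta>: "0 < \<delta>" "AE t in ?M. t < \<delta> \<longrightarrow> \<bar>g t\<bar> \<le> 1 / real (Suc n)"
      using init[of "1 / real (Suc n)"] by auto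
    define r where "r = min (min \<delta> (1 / real (Suc n))) T"
    have r: "0 < r" "r \<le> \<delta>" "r \<le> 1 / real (Suc n)" "r \<le> T" using \<delta> T by (auto simp: r_def)
    have "AE t in ?M. t \<notin> {0<..<r}"
      using h_const \<delta>(2) AE_space
    proof eventually_elim
      case (elim t)
      then show ?case using neg r by auto
    qed
    then have "AE t in lebesgue. t \<notin> {0<..<r}"
      by (subst (asm) AE_restrict_space_iff) (use r in \<open>auto elim!: eventually_mono\<close>)
    then have "{0<..<r} \<in> null_sets lebesgue"
      by (subst (asm) AE_iff_null_sets[symmetric]) auto
    then show False using r by (simp add: null_sets_def)
  qed
  then obtain ts where ts: "\<And>n. ts n \<in> {0<..<T}" "\<And>n. ts n < 1 / real (Suc n)" "\<And>n. h (ts n) = \<kappa>"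
    "\<And>n. \<bar>g (ts n)\<bar> \<le> 1 / real (Suc n)"
    by metis
  have z: "(\<lambda>n. 1 / real (Suc n)) \<longlonglongrightarrow> 0"
    using LIMSEQ_inverse_real_of_nat by (simp add: divide_inverse)
  have "(\<lambda>n. g (ts n)) \<longlonglongrightarrow> 0"
    by (rule Lim_null_comparison[OF _ z]) (use ts(4) in auto)
  moreover have "(\<lambda>n. B (ts n)) \<longlonglongrightarrow> (LINT \<sigma>|?M. 0)"
    unfolding B_def
  proof (rule integral_dominated_convergence)
    show "integrable ?M (\<lambda>\<sigma>. norm (b \<sigma>))" using b by simp
    show "(\<lambda>\<sigma>. indicator {..<ts n} \<sigma> * b \<sigma>) \<in> borel_measurable ?M" for n
      using b borel_measurable_time_measure[of "indicat_real {..<ts n}" T] by simp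
    show "AE \<sigma> in ?M. norm (indicator {..<ts n} \<sigma> * b \<sigma>) \<le> norm (b \<sigma>)" for n
      by (auto split: split_indicator)
    show "AE \<sigma> in ?M. (\<lambda>n. indicator {..<ts n} \<sigma> * b \<sigma>) \<longlonglongrightarrow> 0"
    proof (rule AE_I2)
      fix \<sigma> assume "\<sigma> \<in> space ?M"
      then have "0 < \<sigma>" by simp
      then have "eventually (\<lambda>n. 1 / real (Suc n) < \<sigma>) sequentially"
        using order_tendstoD(2)[OF z] by simp
      then have "eventually (\<lambda>n. indicator {..<ts n} \<sigma> * b \<sigma> = 0) sequentially"
        by eventually_elim (use ts(2) in \<open>auto simp: indicator_def dest: less_trans\<close>)
      then show "(\<lambda>n. indicator {..<ts n} \<sigma> * b \<sigma>) \<longlonglongrightarrow> 0" by (rule tendsto_eventually)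
    qed
  qed simp
  ultimately have "(\<lambda>n. h (ts n)) \<longlonglongrightarrow> 0"
    unfolding h_def using tendsto_diff[of "\<lambda>n. g (ts n)" 0 _ "\<lambda>n. B (ts n)" 0] by simp
  then have "\<kappa> = 0" using ts(3) by (simp add: LIMSEQ_const_iff)
  from h_const show ?thesis
    by eventually_elim (simp add: \<open>\<kappa> = 0\<close> h_def B_def)
qed

section \<open>A short-time uniqueness principle\<close>

text \<open>If \<open>l\<close> vanishes up to time \<open>b\<close>, then \<open>(\<integral>\<^sub>0\<^sup>c l)\<^sup>2 \<le> (c - b) \<integral>\<^sub>0\<^sup>c l\<^sup>2\<close>, so the hypothesis forces
  \<open>l = 0\<close> up to time \<open>c\<close> as soon as \<open>K (c - b) < 1\<close>. Finitely many such steps reach \<open>T\<close>.\<close>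

lemma AE_zero_of_short_time_estimate:
  fixes l :: "real \<Rightarrow> real"
  assumes T: "0 < T" and K: "0 \<le> K" and l: "square_integrable (time_measure T) l"
    and est: "\<And>c. 0 < c \<Longrightarrow> c \<le> T \<Longrightarrow>
      (LINT t|time_measure T. indicator {..<c} t * (l t)\<^sup>2) \<le> K * (LINT t|time_measure T. indicator {..<c} t * l t)\<^sup>2"
  shows "AE t in time_measure T. l t = 0"
proof -
  let ?M = "time_measure T"
  interpret finite_measure ?M by (rule finite_measure_time_measure)
  obtain m :: nat where m: "K * T < real m" using reals_Archimedean2 by blast
  have m0: "0 < real m" using m K T by (smt (verit) mult_nonneg_nonneg)
  define \<delta> where "\<delta> = T / real m"
  have \<delta>: "0 < \<delta>" "K * \<delta> < 1" using m m0 T by (auto simp: \<delta>_def field_simps)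
  have ind: "indicat_real A \<in> borel_measurable ?M" if "A \<in> sets borel" for A
    using that by (intro borel_measurable_time_measure) simp
  have steps: "AE t in ?M. t < real n * \<delta> \<longrightarrow> l t = 0" for n
  proof (induction n)
    case 0
    show ?case by (rule AE_I2) simp
  next
    case (Suc n)
    define b c where "b = real n * \<delta>" and "c = min T (real (Suc n) * \<delta>)"
    show ?case
    proof (cases "T \<le> b")
      case True
      then show ?thesis using Suc.IH AE_space
      proof eventually_elim
        case (elim t)
        then have "t < real n * \<delta>" using True by (simp add: b_def)
        with elim(1) show ?case by simp
      qed
    next
      case False
      have b0: "0 \<le> b" using \<delta> by (simp add: b_def)
      have bc: "b < c" "c \<le> T" "c - b \<le> \<delta>" using False \<delta> by (auto simp: b_def c_def min_def algebra_simps)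
      define X where "X = (LINT t|?M. indicator {..<c} t * (l t)\<^sup>2)"
      have sq: "square_integrable ?M (\<lambda>t. indicator {..<c} t * l t)"
        using l ind[of "{..<c}"] unfolding square_integrable_def
        by (auto intro!: Bochner_Integration.integrable_bound[of ?M "\<lambda>x. (l x)\<^sup>2"] split: split_indicator)
      have sq1: "square_integrable ?M (indicat_real {b..<c})"
        unfolding square_integrable_def using ind[of "{b..<c}"]
        by (auto intro!: integrable_const_bound[of _ 1] split: split_indicator)
      have n1: "(norm2 ?M (\<lambda>t. indicator {..<c} t * l t))\<^sup>2 = X"
        unfolding norm2_power2 X_def
        by (intro Bochner_Integration.integral_cong) (auto split: split_indicator)
      have n2: "(norm2 ?M (indicat_real {b..<c}))\<^sup>2 \<le> c - b"
      proof -
        have "(norm2 ?M (indicat_real {b..<c}))\<^sup>2 = (LINT t|lebesgue. indicator ({0<..<T} \<inter> {b..<c}) t)"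
          unfolding norm2_power2
          by (subst integral_restrict_space, simp, intro Bochner_Integration.integral_cong)
            (auto split: split_indicator)
        also have "\<dots> = measure lebesgue ({0<..<T} \<inter> {b..<c})" by simp
        also have "\<dots> \<le> measure lebesgue {b..c}"
          by (intro measure_mono_fmeasurable) auto
        also have "\<dots> = c - b" using bc by (simp add: measure_completion)
        finally show ?thesis .
      qed
      have "(LINT t|?M. indicator {..<c} t * l t) = (LINT t|?M. indicator {b..<c} t * (indicator {..<c} t * l t))"
      proof (rule integral_cong_AE)
        show "AE t in ?M. indicator {..<c} t * l t = indicator {b..<c} t * (indicator {..<c} t * l t)"
          using Suc.IH by eventually_elim (auto simp: b_def split: split_indicator)
      qed (use sq sq1 in \<open>auto simp: square_integrable_def\<close>)
      also have "\<bar>\<dots>\<bar> \<le> norm2 ?M (indicat_real {b..<c}) * norm2 ?M (\<lambda>t. indicator {..<c} t * l t)"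
        by (rule Cauchy_Schwarz_integral[OF sq1 sq])
      finally have "(LINT t|?M. indicator {..<c} t * l t)\<^sup>2
          \<le> (norm2 ?M (indicat_real {b..<c}))\<^sup>2 * (norm2 ?M (\<lambda>t. indicator {..<c} t * l t))\<^sup>2"
        unfolding power_mult_distrib[symmetric] by (subst abs_le_square_iff[symmetric]) simp
      also have "\<dots> \<le> (c - b) * X"
        unfolding n1 using n2 by (intro mult_right_mono) (auto simp flip: n1)
      finally have "K * (LINT t|?M. indicator {..<c} t * l t)\<^sup>2 \<le> K * ((c - b) * X)"
        by (rule mult_left_mono[OF _ K])
      then have "X \<le> K * ((c - b) * X)"
        using est[of c] b0 bc unfolding X_def[symmetric] by linarith
      also have "\<dots> \<le> K * (\<delta> * X)"
        using bc K by (intro mult_left_mono mult_right_mono) (auto simp flip: n1)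
      finally have "X * (1 - K * \<delta>) \<le> 0" by (simp add: algebra_simps)
      moreover have "0 \<le> X" by (simp flip: n1)
      ultimately have "X = 0" using \<delta>(2) by (simp add: mult_le_0_iff)
      then have "norm2 ?M (\<lambda>t. indicator {..<c} t * l t) = 0" using n1 by simp
      then have "AE t in ?M. indicator {..<c} t * l t = 0"
        using norm2_eq_0_iff[OF sq] by simp
      then show ?thesis
        using AE_space by eventually_elim (simp add: c_def indicator_def split: if_splits)
    qed
  qed
  show ?thesis
    using steps[of m] AE_space by eventually_elim (use m0 in \<open>auto simp: \<delta>_def\<close>)
qed

section \<open>Functions of time with values in the energy space\<close>

text \<open>By completeness of the measure, two functions that agree almost everywhere are both measurable
  or both not, and in the latter case both integrals are \<open>0\<close>. This is used for integrands in time
  whose measurability is not part of the definition of a solution.\<close>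

lemma integral_cong_AE_lebesgue_on:
  fixes f g :: "'b::euclidean_space \<Rightarrow> real"
  assumes S: "S \<in> sets lebesgue" and ae: "AE x in lebesgue_on S. f x = g x"
  shows "(LINT x|lebesgue_on S. f x) = (LINT x|lebesgue_on S. g x)"
proof -
  have *: "g \<in> borel_measurable (lebesgue_on S)"
    if f: "f \<in> borel_measurable (lebesgue_on S)" and ae: "AE x in lebesgue_on S. f x = g x" for f g :: "'b \<Rightarrow> real"
  proof (rule measurableI)
    fix B :: "real set" assume B: "B \<in> sets borel"
    have "{x \<in> S. g x \<in> B} \<in> sets lebesgue"
    proof (rule completion.in_sets_AE)
      have "f -` B \<inter> space (lebesgue_on S) \<in> sets (lebesgue_on S)" by (rule measurable_sets[OF f B])
      then show "{x \<in> S. f x \<in> B} \<in> sets lebesgue"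
        using S by (simp add: sets_restrict_space_iff Int_def conj_commute)
      have "AE x in lebesgue. x \<in> S \<longrightarrow> f x = g x"
        using ae S by (simp add: AE_restrict_space_iff)
      then show "AE x in lebesgue. (x \<in> {x \<in> S. f x \<in> B}) = (x \<in> {x \<in> S. g x \<in> B})"
        by eventually_elim auto
    qed simp
    then show "g -` B \<inter> space (lebesgue_on S) \<in> sets (lebesgue_on S)"
      using S by (simp add: sets_restrict_space_iff Int_def conj_commute)
  qed simp
  have ae': "AE x in lebesgue_on S. g x = f x" using ae by eventually_elim simp
  show ?thesis
  proof (cases "f \<in> borel_measurable (lebesgue_on S)")
    case True
    then show ?thesis using *[OF True ae] ae by (intro integral_cong_AE)
  next
    case False
    then have "g \<notin> borel_measurable (lebesgue_on S)" using *[OF _ ae'] by blast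
    then show ?thesis using False
      by (metis borel_measurable_integrable not_integrable_integral_eq)
  qed
qed

context
  fixes s :: real and \<Omega> :: "'a::euclidean_space set" and T :: real
  assumes s: "0 < s" "s < 1" and T: "0 < T"
begin

lemma X0_norm_diff_le:
  assumes "u \<in> X0 s \<Omega>" "v \<in> X0 s \<Omega>"
  shows "X0_norm s (\<lambda>x. u x - v x) \<le> X0_norm s u + X0_norm s v"
proof -
  have "X0_norm s (\<lambda>x. u x - v x) - X0_norm s (\<lambda>x. - 1 * v x) \<le> X0_norm s (\<lambda>x. (u x - v x) - - 1 * v x)"
    using X0_norm_triangle_diff[OF s X0_diff[OF assms] X0_scale[OF assms(2), of "- 1"]] by linarith
  then show ?thesis using X0_norm_scale[of s "- 1" v] by simp
qed

text \<open>The approximating simple functions are set to \<open>0\<close> wherever their norm exceeds twice the norm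
  of the limit, which makes them dominated without affecting convergence. Setting everything to
  \<open>0\<close> on the exceptional null set makes convergence hold at every time.\<close>

lemma L2_X0_approx:
  assumes u: "u \<in> L2_X0 s \<Omega> T"
  obtains U G where "AE t in time_measure T. U t = u t" "\<And>t. U t \<in> X0 s \<Omega>"
    "\<And>n. simple_function (time_measure T) (G n)" "\<And>n t. G n t \<in> X0 s \<Omega>"
    "\<And>t. (\<lambda>n. X0_norm s (\<lambda>x. G n t x - U t x)) \<longlonglongrightarrow> 0"
    "\<And>n t. X0_norm s (G n t) \<le> 2 * X0_norm s (U t)"
    "integrable (time_measure T) (\<lambda>t. (X0_norm s (U t))\<^sup>2)"
proof -
  let ?M = "time_measure T"
  obtain F where F: "\<And>n. simple_function ?M (F n)" "\<And>n. F n ` space ?M \<subseteq> X0 s \<Omega>"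
    "AE t in ?M. u t \<in> X0 s \<Omega> \<and> (\<lambda>n. X0_norm s (F n t - u t)) \<longlonglongrightarrow> 0"
    and int: "integrable ?M (\<lambda>t. (X0_norm s (u t))\<^sup>2)"
  proof -
    have "strongly_measurable_in (X0 s \<Omega>) (X0_norm s) ?M u"
      and int: "integrable ?M (\<lambda>t. (X0_norm s (u t))\<^sup>2)"
      using u by (simp_all add: L2_X0_def bochner_L2_def)
    from this(1) obtain F :: "nat \<Rightarrow> real \<Rightarrow> 'a \<Rightarrow> real" where
      "(\<forall>n. simple_function ?M (F n) \<and> F n ` space ?M \<subseteq> X0 s \<Omega>) \<and>
        (AE t in ?M. u t \<in> X0 s \<Omega> \<and> (\<lambda>n. X0_norm s (F n t - u t)) \<longlonglongrightarrow> 0)"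
      unfolding strongly_measurable_in_def by (elim exE)
    then show thesis using that[of F] int by simp
  qed
  obtain N where N: "\<And>t. t \<in> space ?M - N \<Longrightarrow> u t \<in> X0 s \<Omega> \<and> (\<lambda>n. X0_norm s (F n t - u t)) \<longlonglongrightarrow> 0"
    "N \<in> null_sets ?M"
    using AE_E3[OF F(3)] by metis
  define A where "A = space ?M - N"
  have A: "A \<in> sets ?M" "A \<subseteq> space ?M" using N(2) by (auto simp: A_def)
  have AE_A: "AE t in ?M. t \<in> A"
    using AE_not_in[OF N(2)] AE_space by eventually_elim (auto simp: A_def)
  have uA: "u t \<in> X0 s \<Omega>" "(\<lambda>n. X0_norm s (\<lambda>x. F n t x - u t x)) \<longlonglongrightarrow> 0" "\<And>n. F n t \<in> X0 s \<Omega>" if "t \<in> A" for t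
  proof -
    have t: "t \<in> space ?M" "t \<notin> N" using that by (simp_all add: A_def)
    then show "u t \<in> X0 s \<Omega>" using N(1)[of t] by simp
    have "(\<lambda>n. X0_norm s (F n t - u t)) \<longlonglongrightarrow> 0" using t N(1)[of t] by simp
    then show "(\<lambda>n. X0_norm s (\<lambda>x. F n t x - u t x)) \<longlonglongrightarrow> 0" by (simp add: fun_diff_def)
    show "F n t \<in> X0 s \<Omega>" for n using F(2)[of n] t(1) by blast
  qed
  define U where "U t = (if t \<in> A then u t else (\<lambda>x. 0))" for t
  define good where "good n = {t \<in> A. X0_norm s (F n t) \<le> 2 * X0_norm s (u t)}" for n
  define G where "G n t = (if t \<in> good n then F n t else (\<lambda>x. 0))" for n t
  have mu: "(\<lambda>t. X0_norm s (u t)) \<in> borel_measurable ?M"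
  proof -
    have "(\<lambda>t. sqrt ((X0_norm s (u t))\<^sup>2)) \<in> borel_measurable ?M"
      using borel_measurable_integrable[OF int] by measurable
    then show ?thesis by (simp add: X0_norm_nonneg[OF s])
  qed
  have mF: "(\<lambda>t. X0_norm s (F n t)) \<in> borel_measurable ?M" for n
    by (intro borel_measurable_simple_function simple_function_compose1[OF F(1)])
  have good: "good n \<in> sets ?M" for n
  proof -
    have "{t \<in> space ?M. X0_norm s (F n t) \<le> 2 * X0_norm s (u t)} \<in> sets ?M"
      by (rule borel_measurable_le[OF mF borel_measurable_times[OF borel_measurable_const mu]])
    moreover have "good n = A \<inter> {t \<in> space ?M. X0_norm s (F n t) \<le> 2 * X0_norm s (u t)}"
      using A(2) unfolding good_def by blast
    ultimately show ?thesis using A(1) by auto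
  qed
  show thesis
  proof (rule that[of U G])
    show aeU: "AE t in ?M. U t = u t"
      using AE_A by eventually_elim (simp add: U_def)
    show UX: "U t \<in> X0 s \<Omega>" for t
      using uA(1)[of t] X0_zero by (cases "t \<in> A") (simp_all add: U_def)
    show "simple_function ?M (G n)" for n
      unfolding G_def[abs_def]
      using good[of n] by (intro simple_function_If_set[OF F(1)] simple_function_const sets.Int) simp_all
    show GX: "G n t \<in> X0 s \<Omega>" for n t
      using uA(3)[of t n] X0_zero by (cases "t \<in> good n") (simp_all add: G_def good_def)
    show "X0_norm s (G n t) \<le> 2 * X0_norm s (U t)" for n t
    proof (cases "t \<in> good n")
      case True
      then show ?thesis by (simp add: G_def U_def good_def)
    next
      case False
      then show ?thesis using X0_norm_nonneg[OF s, of "U t"] by (simp add: G_def)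
    qed
    show "(\<lambda>n. X0_norm s (\<lambda>x. G n t x - U t x)) \<longlonglongrightarrow> 0" for t
    proof (cases "t \<in> A")
      case False
      then show ?thesis by (simp add: G_def good_def U_def)
    next
      case True
      show ?thesis
      proof (cases "X0_norm s (u t) = 0")
        case 0: True
        have "X0_norm s (\<lambda>x. G n t x - U t x) = 0" for n
        proof -
          have "X0_norm s (G n t) \<le> 0" using True 0 by (auto simp: G_def good_def)
          then have "X0_norm s (\<lambda>x. G n t x - U t x) \<le> 0"
            using X0_norm_diff_le[OF GX[of n t] UX[of t]] 0 True by (simp add: U_def)
          then show ?thesis using X0_norm_nonneg[OF s] by (rule order_antisym)
        qed
        then show ?thesis by simp
      next
        case False
        then have pos: "0 < X0_norm s (u t)" using X0_norm_nonneg[OF s, of "u t"] by simp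
        have "eventually (\<lambda>n. X0_norm s (\<lambda>x. F n t x - u t x) < X0_norm s (u t)) sequentially"
          using order_tendstoD(2)[OF uA(2)[OF True] pos] .
        then have "eventually (\<lambda>n. X0_norm s (\<lambda>x. F n t x - u t x) = X0_norm s (\<lambda>x. G n t x - U t x)) sequentially"
        proof eventually_elim
          case (elim n)
          then have "X0_norm s (F n t) \<le> 2 * X0_norm s (u t)"
            using X0_norm_triangle_diff[OF s uA(3)[OF True, of n] uA(1)[OF True]] by linarith
          then show ?case using True by (simp add: G_def good_def U_def)
        qed
        then show ?thesis by (rule Lim_transform_eventually[OF uA(2)[OF True]])
      qed
    qed
    show "integrable ?M (\<lambda>t. (X0_norm s (U t))\<^sup>2)"
    proof -
      have "integrable ?M (\<lambda>t. indicat_real A t *\<^sub>R (X0_norm s (u t))\<^sup>2)"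
        by (rule integrable_mult_indicator[OF A(1) int])
      moreover have "(\<lambda>t. (X0_norm s (U t))\<^sup>2) = (\<lambda>t. indicat_real A t *\<^sub>R (X0_norm s (u t))\<^sup>2)"
        by (auto simp: U_def)
      ultimately show ?thesis by simp
    qed
  qed
qed

end

lemma (in finite_measure) integral_compose_simple_function:
  fixes h :: "'c \<Rightarrow> real"
  assumes g: "simple_function M g"
  shows "(LINT t|M. h (g t)) = (\<Sum>v\<in>g ` space M. measure M (g -` {v} \<inter> space M) * h v)"
proof -
  have fin: "finite (g ` space M)" and ms: "g -` {v} \<inter> space M \<in> sets M" for v
    using g by (auto intro: simple_functionD)
  have "(LINT t|M. h (g t)) = (LINT t|M. (\<Sum>v\<in>g ` space M. indicator (g -` {v} \<inter> space M) t * h v))"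
  proof (intro Bochner_Integration.integral_cong refl)
    fix t assume t: "t \<in> space M"
    have "(\<Sum>v\<in>g ` space M. indicator (g -` {v} \<inter> space M) t * h v) = (\<Sum>v\<in>g ` space M. if v = g t then h v else 0)"
      using t by (intro sum.cong) (auto simp: indicator_def)
    then show "h (g t) = (\<Sum>v\<in>g ` space M. indicator (g -` {v} \<inter> space M) t * h v)"
      using t fin by simp
  qed
  also have "\<dots> = (\<Sum>v\<in>g ` space M. LINT t|M. indicator (g -` {v} \<inter> space M) t * h v)"
  proof (rule Bochner_Integration.integral_sum)
    fix v
    have "integrable M (indicat_real (g -` {v} \<inter> space M))"
      by (intro integrable_const_bound[where B = 1] borel_measurable_indicator ms) (simp split: split_indicator)
    then show "integrable M (\<lambda>t. indicator (g -` {v} \<inter> space M) t * h v)" by simp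
  qed
  also have "\<dots> = (\<Sum>v\<in>g ` space M. measure M (g -` {v} \<inter> space M) * h v)"
    using ms by (simp add: Int_assoc)
  finally show ?thesis .
qed

lemma borel_measurable_energy_simple:
  assumes "simple_function M g"
  shows "(\<lambda>z. energy s (g (fst z)) (g (snd z))) \<in> borel_measurable (M \<Otimes>\<^sub>M M)"
proof -
  have "simple_function (M \<Otimes>\<^sub>M M) (\<lambda>z. g (fst z))" "simple_function (M \<Otimes>\<^sub>M M) (\<lambda>z. g (snd z))"
    by (rule simple_function_comp[OF measurable_fst assms], rule simple_function_comp[OF measurable_snd assms])
  then show ?thesis
    by (intro borel_measurable_simple_function simple_function_compose2[where h="energy s"])
qed

context
  fixes s :: real and \<Omega> :: "'a::euclidean_space set" and T :: real
    and U :: "real \<Rightarrow> 'a \<Rightarrow> real" and G :: "nat \<Rightarrow> real \<Rightarrow> 'a \<Rightarrow> real"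
  assumes s: "0 < s" "s < 1" and T: "0 < T"
    and U: "\<And>t. U t \<in> X0 s \<Omega>"
    and G_simple: "\<And>n. simple_function (time_measure T) (G n)" and G: "\<And>n t. G n t \<in> X0 s \<Omega>"
    and lim: "\<And>t. (\<lambda>n. X0_norm s (\<lambda>x. G n t x - U t x)) \<longlonglongrightarrow> 0"
    and le: "\<And>n t. X0_norm s (G n t) \<le> 2 * X0_norm s (U t)"
    and int: "integrable (time_measure T) (\<lambda>t. (X0_norm s (U t))\<^sup>2)"
begin

text \<open>A functional of a simple function is simple, and Lipschitz continuity in the energy norm both
  passes this to the limit \<open>U\<close> and bounds the result by a multiple of the norm of \<open>U\<close>.\<close>

lemma integrable_Lipschitz_functional:
  assumes lip: "\<And>v w. v \<in> X0 s \<Omega> \<Longrightarrow> w \<in> X0 s \<Omega> \<Longrightarrow> \<bar>\<Phi> v - \<Phi> w\<bar> \<le> C * X0_norm s (\<lambda>x. v x - w x)"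
    and zero: "\<Phi> (\<lambda>x. 0) = 0"
  shows "integrable (time_measure T) (\<lambda>t. \<Phi> (U t) :: real)"
proof -
  interpret finite_measure "time_measure T" by (rule finite_measure_time_measure)
  have lims: "(\<lambda>n. \<Phi> (G n t)) \<longlonglongrightarrow> \<Phi> (U t)" if L: "\<And>v w. v \<in> X0 s \<Omega> \<Longrightarrow> w \<in> X0 s \<Omega> \<Longrightarrow>
      \<bar>\<Phi> v - \<Phi> w\<bar> \<le> C * X0_norm s (\<lambda>x. v x - w x)" for \<Phi> :: "('a \<Rightarrow> real) \<Rightarrow> real" and C t
  proof -
    have "(\<lambda>n. \<Phi> (G n t) - \<Phi> (U t)) \<longlonglongrightarrow> 0"
    proof (rule Lim_null_comparison)
      show "(\<lambda>n. C * X0_norm s (\<lambda>x. G n t x - U t x)) \<longlonglongrightarrow> 0"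
        using tendsto_mult_left[OF lim, of C t] by simp
      show "\<forall>\<^sub>F n in sequentially. norm (\<Phi> (G n t) - \<Phi> (U t)) \<le> C * X0_norm s (\<lambda>x. G n t x - U t x)"
        by (intro always_eventually allI, unfold real_norm_def, rule L[OF G U])
    qed
    then show ?thesis by (rule LIM_zero_cancel)
  qed
  have meas: "(\<lambda>t. \<Phi> (U t)) \<in> borel_measurable (time_measure T)" if "\<And>v w. v \<in> X0 s \<Omega> \<Longrightarrow> w \<in> X0 s \<Omega> \<Longrightarrow>
      \<bar>\<Phi> v - \<Phi> w\<bar> \<le> C * X0_norm s (\<lambda>x. v x - w x)" for \<Phi> :: "('a \<Rightarrow> real) \<Rightarrow> real" and C
  proof (rule borel_measurable_LIMSEQ_real)
    show "(\<lambda>t. \<Phi> (G n t)) \<in> borel_measurable (time_measure T)" for n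
      by (intro borel_measurable_simple_function simple_function_compose1[OF G_simple])
    show "(\<lambda>n. \<Phi> (G n t)) \<longlonglongrightarrow> \<Phi> (U t)" for t by (rule lims[OF that])
  qed
  have "(\<lambda>t. X0_norm s (U t)) \<in> borel_measurable (time_measure T)"
    by (rule meas[of "X0_norm s" 1], unfold mult_1, rule X0_norm_triangle_diff[OF s, of _ \<Omega>])
  then have "integrable (time_measure T) (\<lambda>t. C * X0_norm s (U t))"
    by (rule integrable_mult_right[OF square_integrable_imp_integrable[OF _ int]])
  then show ?thesis
  proof (rule Bochner_Integration.integrable_bound)
    show "(\<lambda>t. \<Phi> (U t)) \<in> borel_measurable (time_measure T)" by (rule meas[OF lip])
    show "AE t in time_measure T. norm (\<Phi> (U t)) \<le> norm (C * X0_norm s (U t))"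
    proof (rule AE_I2)
      fix t
      have "\<bar>\<Phi> (U t)\<bar> \<le> C * X0_norm s (U t)" using lip[OF U[of t] X0_zero] zero by simp
      then show "norm (\<Phi> (U t)) \<le> norm (C * X0_norm s (U t))" unfolding real_norm_def by linarith
    qed
  qed
qed

lemma integrable_X0_norm: "integrable (time_measure T) (\<lambda>t. X0_norm s (U t))"
proof (rule integrable_Lipschitz_functional)
  show "\<bar>X0_norm s v - X0_norm s w\<bar> \<le> 1 * X0_norm s (\<lambda>x. v x - w x)"
    if "v \<in> X0 s \<Omega>" "w \<in> X0 s \<Omega>" for v w
    unfolding mult_1 by (rule X0_norm_triangle_diff[OF s that])
qed (rule X0_norm_zero)

lemma energy_tendsto: "(\<lambda>n. energy s (G n \<tau>) (G n \<sigma>)) \<longlonglongrightarrow> energy s (U \<tau>) (U \<sigma>)"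
proof -
  have "(\<lambda>n. energy s (G n \<tau>) (G n \<sigma>) - energy s (U \<tau>) (U \<sigma>)) \<longlonglongrightarrow> 0"
  proof (rule Lim_null_comparison)
    show "(\<lambda>n. 2 * X0_norm s (U \<tau>) * X0_norm s (\<lambda>x. G n \<sigma> x - U \<sigma> x)
        + X0_norm s (\<lambda>x. G n \<tau> x - U \<tau> x) * X0_norm s (U \<sigma>)) \<longlonglongrightarrow> 0"
      using tendsto_add[OF tendsto_mult_left[OF lim, of "2 * X0_norm s (U \<tau>)" \<sigma>]
        tendsto_mult_right[OF lim, of \<tau> "X0_norm s (U \<sigma>)"]] by simp
    show "\<forall>\<^sub>F n in sequentially. norm (energy s (G n \<tau>) (G n \<sigma>) - energy s (U \<tau>) (U \<sigma>))
        \<le> 2 * X0_norm s (U \<tau>) * X0_norm s (\<lambda>x. G n \<sigma> x - U \<sigma> x)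
        + X0_norm s (\<lambda>x. G n \<tau> x - U \<tau> x) * X0_norm s (U \<sigma>)"
    proof (rule always_eventually, rule allI)
      fix n
      have "energy s (G n \<tau>) (G n \<sigma>) - energy s (U \<tau>) (U \<sigma>) =
          energy s (G n \<tau>) (\<lambda>x. G n \<sigma> x - U \<sigma> x) + energy s (\<lambda>x. G n \<tau> x - U \<tau> x) (U \<sigma>)"
        using energy_diff_right[OF s G[of n \<tau>] G[of n \<sigma>] U[of \<sigma>]]
            energy_diff_left[OF s U[of \<sigma>] G[of n \<tau>] U[of \<tau>]] by simp
      moreover have "\<bar>energy s (G n \<tau>) (\<lambda>x. G n \<sigma> x - U \<sigma> x)\<bar> \<le>
          X0_norm s (G n \<tau>) * X0_norm s (\<lambda>x. G n \<sigma> x - U \<sigma> x)"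
        by (rule abs_energy_le[OF s G X0_diff[OF G U]])
      moreover have "X0_norm s (G n \<tau>) * X0_norm s (\<lambda>x. G n \<sigma> x - U \<sigma> x) \<le>
          2 * X0_norm s (U \<tau>) * X0_norm s (\<lambda>x. G n \<sigma> x - U \<sigma> x)"
        by (rule mult_right_mono[OF le X0_norm_nonneg[OF s]])
      moreover have "\<bar>energy s (\<lambda>x. G n \<tau> x - U \<tau> x) (U \<sigma>)\<bar> \<le>
          X0_norm s (\<lambda>x. G n \<tau> x - U \<tau> x) * X0_norm s (U \<sigma>)"
        by (rule abs_energy_le[OF s X0_diff[OF G U] U])
      ultimately show "norm (energy s (G n \<tau>) (G n \<sigma>) - energy s (U \<tau>) (U \<sigma>))
        \<le> 2 * X0_norm s (U \<tau>) * X0_norm s (\<lambda>x. G n \<sigma> x - U \<sigma> x)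
        + X0_norm s (\<lambda>x. G n \<tau> x - U \<tau> x) * X0_norm s (U \<sigma>)"
        by simp
    qed
  qed
  then show ?thesis by (rule LIM_zero_cancel)
qed

text \<open>The integrand is symmetric and the diagonal is a null set, so the integral over the triangle
  \<open>\<sigma> < \<tau>\<close> is half of the integral over the square. For simple functions the latter is a Gram sum
  of the energy; dominated convergence carries its sign over to \<open>U\<close>.\<close>

lemma energy_triangle_integral:
  shows "integrable (time_measure T) (\<lambda>\<tau>. LINT \<sigma>|time_measure T. indicator {..<\<tau>} \<sigma> * energy s (U \<sigma>) (U \<tau>))"
    and "0 \<le> (LINT \<tau>|time_measure T. LINT \<sigma>|time_measure T. indicator {..<\<tau>} \<sigma> * energy s (U \<sigma>) (U \<tau>))"
proof -
  let ?M = "time_measure T"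
  interpret M: finite_measure ?M by (rule finite_measure_time_measure)
  interpret P: pair_sigma_finite ?M ?M by (rule pair_sigma_finite_time_measure)
  define e where "e z = energy s (U (fst z)) (U (snd z))" for z
  define en where "en n z = energy s (G n (fst z)) (G n (snd z))" for n z
  have men: "en n \<in> borel_measurable (?M \<Otimes>\<^sub>M ?M)" for n
    unfolding en_def[abs_def] by (rule borel_measurable_energy_simple[OF G_simple])
  have en_lim: "(\<lambda>n. en n z) \<longlonglongrightarrow> e z" for z
    unfolding en_def e_def by (rule energy_tendsto)
  have me: "e \<in> borel_measurable (?M \<Otimes>\<^sub>M ?M)"
    by (rule borel_measurable_LIMSEQ_real[OF _ men]) (rule en_lim)
  have fs: "fst \<in> ?M \<Otimes>\<^sub>M ?M \<rightarrow>\<^sub>M ?M" "snd \<in> ?M \<Otimes>\<^sub>M ?M \<rightarrow>\<^sub>M ?M" by simp_all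
  define w where "w z = X0_norm s (U (fst z)) * X0_norm s (U (snd z))" for z
  have mw: "w \<in> borel_measurable (?M \<Otimes>\<^sub>M ?M)"
    unfolding w_def[abs_def] using borel_measurable_integrable[OF integrable_X0_norm]
    by (intro borel_measurable_times measurable_compose[OF fs(1)] measurable_compose[OF fs(2)])
  have wint: "integrable (?M \<Otimes>\<^sub>M ?M) w"
  proof (rule P.Fubini_integrable[OF mw])
    show "integrable ?M (\<lambda>\<tau>. LINT \<sigma>|?M. norm (w (\<tau>, \<sigma>)))"
      using integrable_X0_norm by (simp add: w_def abs_mult X0_norm_nonneg[OF s])
    show "AE \<tau> in ?M. integrable ?M (\<lambda>\<sigma>. w (\<tau>, \<sigma>))"
      using integrable_X0_norm by (simp add: w_def)
  qed
  have e_le: "norm (e z) \<le> norm (w z)" for z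
    using abs_energy_le[OF s U U] by (simp add: e_def w_def abs_mult X0_norm_nonneg[OF s])
  have en_le: "norm (en n z) \<le> 4 * w z" for n z
  proof -
    have "norm (en n z) \<le> X0_norm s (G n (fst z)) * X0_norm s (G n (snd z))"
      using abs_energy_le[OF s G G] by (simp add: en_def)
    also have "\<dots> \<le> (2 * X0_norm s (U (fst z))) * (2 * X0_norm s (U (snd z)))"
      by (intro mult_mono le) (simp_all add: X0_norm_nonneg[OF s])
    finally show ?thesis by (simp add: w_def)
  qed
  have eint: "integrable (?M \<Otimes>\<^sub>M ?M) e"
    by (rule Bochner_Integration.integrable_bound[OF wint me], rule AE_I2, rule e_le)
  have "0 \<le> integral\<^sup>L (?M \<Otimes>\<^sub>M ?M) e"
  proof (rule LIMSEQ_le_const)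
    show "(\<lambda>n. integral\<^sup>L (?M \<Otimes>\<^sub>M ?M) (en n)) \<longlonglongrightarrow> integral\<^sup>L (?M \<Otimes>\<^sub>M ?M) e"
    proof (rule integral_dominated_convergence[OF me men])
      show "integrable (?M \<Otimes>\<^sub>M ?M) (\<lambda>z. 4 * w z)" using wint by simp
      show "AE z in ?M \<Otimes>\<^sub>M ?M. (\<lambda>n. en n z) \<longlonglongrightarrow> e z" by (rule AE_I2, rule en_lim)
      show "AE z in ?M \<Otimes>\<^sub>M ?M. norm (en n z) \<le> 4 * w z" for n by (rule AE_I2, rule en_le)
    qed
    have "0 \<le> integral\<^sup>L (?M \<Otimes>\<^sub>M ?M) (en n)" for n
    proof -
      define S where "S = G n ` space ?M"
      define m where "m v = measure ?M (G n -` {v} \<inter> space ?M)" for v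
      have S: "finite S" "S \<subseteq> X0 s \<Omega>"
        using simple_functionD(1)[OF G_simple[of n]] G by (auto simp: S_def)
      have "integrable (?M \<Otimes>\<^sub>M ?M) (en n)"
      proof (rule Bochner_Integration.integrable_bound[OF _ men])
        show "integrable (?M \<Otimes>\<^sub>M ?M) (\<lambda>z. 4 * w z)" using wint by simp
        have "norm (en n z) \<le> norm (4 * w z)" for z
          using en_le[of n z] by (rule order_trans) simp
        then show "AE z in ?M \<Otimes>\<^sub>M ?M. norm (en n z) \<le> norm (4 * w z)" by (intro AE_I2)
      qed
      then have "integral\<^sup>L (?M \<Otimes>\<^sub>M ?M) (en n) = (LINT \<tau>|?M. LINT \<sigma>|?M. energy s (G n \<tau>) (G n \<sigma>))"
        using P.integral_fst'[of "en n"] by (simp add: en_def)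
      also have "\<dots> = (\<Sum>v\<in>S. m v * (\<Sum>w\<in>S. m w * energy s v w))"
        unfolding M.integral_compose_simple_function[OF G_simple, of "energy s _"]
          M.integral_compose_simple_function[OF G_simple, of "\<lambda>v. \<Sum>w\<in>G n ` space ?M. measure ?M (G n -` {w} \<inter> space ?M) * energy s v w"]
        by (simp add: S_def m_def)
      also have "\<dots> = (\<Sum>v\<in>S. \<Sum>w\<in>S. m v * m w * energy s v w)"
        by (simp add: sum_distrib_left mult.assoc)
      finally show ?thesis using energy_Gram_nonneg[OF s S] by simp
    qed
    then show "\<exists>N. \<forall>n\<ge>N. 0 \<le> integral\<^sup>L (?M \<Otimes>\<^sub>M ?M) (en n)" by blast
  qed
  define lo where "lo z = indicator {z. snd z < fst z} (z :: real \<times> real) * e z" for z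
  define up where "up z = indicator {z. fst z < snd z} (z :: real \<times> real) * e z" for z
  have idm: "(\<lambda>t. t) \<in> borel_measurable ?M" by (intro borel_measurable_time_measure) simp
  note fsb = measurable_compose[OF fs(1) idm] measurable_compose[OF fs(2) idm]
  have "{z \<in> space (?M \<Otimes>\<^sub>M ?M). snd z < fst z} \<in> sets (?M \<Otimes>\<^sub>M ?M)"
    "{z \<in> space (?M \<Otimes>\<^sub>M ?M). fst z < snd z} \<in> sets (?M \<Otimes>\<^sub>M ?M)"
    and ne: "{z \<in> space (?M \<Otimes>\<^sub>M ?M). fst z \<noteq> snd z} \<in> sets (?M \<Otimes>\<^sub>M ?M)"
    using fsb by measurable
  then have ind: "indicat_real {z. snd z < fst z} \<in> borel_measurable (?M \<Otimes>\<^sub>M ?M)"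
    "indicat_real {z. fst z < snd z} \<in> borel_measurable (?M \<Otimes>\<^sub>M ?M)"
    by (simp_all add: borel_measurable_indicator_iff Int_def conj_commute)
  have loint: "integrable (?M \<Otimes>\<^sub>M ?M) lo" and upint: "integrable (?M \<Otimes>\<^sub>M ?M) up"
    unfolding lo_def[abs_def] up_def[abs_def] using me ind
    by (auto intro!: Bochner_Integration.integrable_bound[OF eint] split: split_indicator)
  have swap: "integral\<^sup>L (?M \<Otimes>\<^sub>M ?M) up = integral\<^sup>L (?M \<Otimes>\<^sub>M ?M) lo"
  proof -
    have "(\<lambda>(x, y). up (y, x)) = lo"
      by (auto simp: up_def lo_def e_def energy_commute split: split_indicator)
    then show ?thesis using P.integral_product_swap[OF borel_measurable_integrable[OF upint]] by simp
  qed
  have off_diag: "AE z in ?M \<Otimes>\<^sub>M ?M. fst z \<noteq> snd z"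
  proof (rule P.AE_pair_measure[OF ne])
    have "AE \<sigma> in ?M. \<tau> \<noteq> \<sigma>" for \<tau>
    proof -
      have "AE \<sigma> in lebesgue. \<sigma> \<noteq> \<tau>" using AE_lborel_singleton[of \<tau>] by (rule AE_completion)
      then show ?thesis by (simp add: AE_restrict_space_iff) (auto elim: eventually_mono)
    qed
    then show "AE \<tau> in ?M. AE \<sigma> in ?M. fst (\<tau>, \<sigma>) \<noteq> snd (\<tau>, \<sigma>)" by simp
  qed
  have "integral\<^sup>L (?M \<Otimes>\<^sub>M ?M) e = integral\<^sup>L (?M \<Otimes>\<^sub>M ?M) (\<lambda>z. lo z + up z)"
  proof (rule integral_cong_AE[OF me])
    show "(\<lambda>z. lo z + up z) \<in> borel_measurable (?M \<Otimes>\<^sub>M ?M)" using loint upint by simp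
    show "AE z in ?M \<Otimes>\<^sub>M ?M. e z = lo z + up z"
      using off_diag by eventually_elim (auto simp: lo_def up_def indicator_def)
  qed
  also have "\<dots> = 2 * integral\<^sup>L (?M \<Otimes>\<^sub>M ?M) lo"
    using loint upint swap by simp
  finally have "0 \<le> integral\<^sup>L (?M \<Otimes>\<^sub>M ?M) lo"
    using \<open>0 \<le> integral\<^sup>L (?M \<Otimes>\<^sub>M ?M) e\<close> by simp
  moreover have lo_eq: "lo (\<tau>, \<sigma>) = indicator {..<\<tau>} \<sigma> * energy s (U \<sigma>) (U \<tau>)" for \<tau> \<sigma>
    by (auto simp: lo_def e_def energy_commute split: split_indicator)
  ultimately show "0 \<le> (LINT \<tau>|?M. LINT \<sigma>|?M. indicator {..<\<tau>} \<sigma> * energy s (U \<sigma>) (U \<tau>))"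
    using P.integral_fst'[OF loint] by simp
  show "integrable ?M (\<lambda>\<tau>. LINT \<sigma>|?M. indicator {..<\<tau>} \<sigma> * energy s (U \<sigma>) (U \<tau>))"
    using P.integrable_fst'[OF loint] by (simp add: lo_eq)
qed

end

lemma integrable_mult_halfline:
  assumes "integrable (time_measure T) f"
  shows "integrable (time_measure T) (\<lambda>t. indicat_real {..<c} t * f t)"
proof (rule Bochner_Integration.integrable_bound[OF assms])
  show "(\<lambda>t. indicat_real {..<c} t * f t) \<in> borel_measurable (time_measure T)"
    using assms borel_measurable_time_measure[of "indicat_real {..<c}" T] by simp
  show "AE t in time_measure T. norm (indicat_real {..<c} t * f t) \<le> norm (f t)"
    by (rule AE_I2) (simp split: split_indicator)
qed

section \<open>Uniqueness of finite energy solutions\<close>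

lemma separated_in_L2_X0:
  assumes v: "v \<in> X0 s \<Omega>" and \<phi>: "continuous_on UNIV \<phi>"
  shows "(\<lambda>t x. \<phi> t * v x) \<in> L2_X0 s \<Omega> T"
proof -
  let ?M = "time_measure T"
  have "\<phi> \<in> borel_measurable ?M"
    by (intro borel_measurable_time_measure borel_measurable_continuous_onI \<phi>)
  then obtain \<phi>n where \<phi>n: "\<And>n. simple_function ?M (\<phi>n n)" "\<And>t. t \<in> space ?M \<Longrightarrow> (\<lambda>n. \<phi>n n t) \<longlonglongrightarrow> \<phi> t"
    using borel_measurable_implies_sequence_metric[of \<phi> ?M 0] by metis
  have "strongly_measurable_in (X0 s \<Omega>) (X0_norm s) ?M (\<lambda>t x. \<phi> t * v x)"
    unfolding strongly_measurable_in_def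
  proof (intro exI[of _ "\<lambda>n t x. \<phi>n n t * v x"] conjI allI)
    show "simple_function ?M (\<lambda>t x. \<phi>n n t * v x)" for n
      by (rule simple_function_compose1[OF \<phi>n(1)])
    show "(\<lambda>t x. \<phi>n n t * v x) ` space ?M \<subseteq> X0 s \<Omega>" for n
      using X0_scale[OF v] by blast
    show "AE t in ?M. (\<lambda>x. \<phi> t * v x) \<in> X0 s \<Omega> \<and>
        (\<lambda>n. X0_norm s ((\<lambda>x. \<phi>n n t * v x) - (\<lambda>x. \<phi> t * v x))) \<longlonglongrightarrow> 0"
    proof (rule AE_I2, rule conjI)
      fix t assume t: "t \<in> space ?M"
      show "(\<lambda>x. \<phi> t * v x) \<in> X0 s \<Omega>" by (rule X0_scale[OF v])
      have "X0_norm s ((\<lambda>x. \<phi>n n t * v x) - (\<lambda>x. \<phi> t * v x)) = \<bar>\<phi>n n t - \<phi> t\<bar> * X0_norm s v" for n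
        by (simp add: fun_diff_def left_diff_distrib[symmetric] X0_norm_scale)
      moreover have "(\<lambda>n. \<bar>\<phi>n n t - \<phi> t\<bar> * X0_norm s v) \<longlonglongrightarrow> \<bar>\<phi> t - \<phi> t\<bar> * X0_norm s v"
        by (intro tendsto_intros \<phi>n(2)[OF t])
      ultimately show "(\<lambda>n. X0_norm s ((\<lambda>x. \<phi>n n t * v x) - (\<lambda>x. \<phi> t * v x))) \<longlonglongrightarrow> 0" by simp
    qed
  qed
  moreover have "integrable ?M (\<lambda>t. (X0_norm s (\<lambda>x. \<phi> t * v x))\<^sup>2)"
    unfolding X0_norm_scale
    by (intro integrable_time_measure_continuous continuous_intros continuous_on_subset[OF \<phi>]) simp
  ultimately show ?thesis by (simp add: L2_X0_def bochner_L2_def)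
qed

text \<open>Only the values of the nonlinearity along the solution matter, so a globally Lipschitz \<open>R\<close> that
  agrees with it there may replace it.\<close>

lemma solution_eq_zero_if_Lipschitz:
  fixes \<Omega> :: "'a::euclidean_space set"
  assumes \<Omega>: "bounded \<Omega>" "open \<Omega>" and s: "0 < s" "s < 1" and T: "0 < T"
    and q: "q \<in> borel_measurable (lebesgue_on \<Omega>)" "AE x in lebesgue_on \<Omega>. \<bar>q x\<bar> \<le> Q"
    and R: "\<And>a b. \<bar>R a - R b\<bar> \<le> K * \<bar>a - b\<bar>" "R 0 = 0"
    and sol: "finite_energy_solution s \<Omega> T \<alpha> q u"
    and reaction_eq: "AE t in time_measure T. AE x in lebesgue_on \<Omega>. reaction \<alpha> (u t x) = R (u t x)"
  shows "AE t in time_measure T. AE x in lebesgue. u t x = 0"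
proof -
  let ?M = "time_measure T" and ?L = "lebesgue_on \<Omega>"
  have \<Omega>m: "\<Omega> \<in> sets lebesgue" using \<Omega>(2) by (simp add: borel_open)
  obtain P where P: "0 < P" "\<And>v. v \<in> X0 s \<Omega> \<Longrightarrow> norm2 ?L v \<le> P * X0_norm s v"
    using fractional_Poincare[OF s \<Omega>(1) \<Omega>m] by blast
  have K: "0 \<le> K" using R(1)[of 1 0] by simp
  define \<kappa> where "\<kappa> = \<bar>Q\<bar> * K"
  have \<kappa>: "0 \<le> \<kappa>" using K by (simp add: \<kappa>_def)
  have nn: "0 \<le> X0_norm s v" for v :: "'a \<Rightarrow> real" by (rule X0_norm_nonneg[OF s])
  have sqL: "square_integrable ?L v" if "v \<in> X0 s \<Omega>" for v
    using that \<Omega>m by (intro square_integrable_lebesgue_on) (simp_all add: X0_iff)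
  define F where "F v x = q x * R (v x)" for v :: "'a \<Rightarrow> real" and x
  have Rm: "R \<in> borel_measurable borel"
  proof -
    have "K-lipschitz_on UNIV R"
      using R(1) K by (intro lipschitz_onI) (simp_all add: dist_real_def)
    then show ?thesis by (intro borel_measurable_continuous_onI lipschitz_on_continuous_on)
  qed
  have Fm: "F v \<in> borel_measurable ?L" if "v \<in> X0 s \<Omega>" for v
    unfolding F_def[abs_def] using square_integrable_measurable[OF sqL[OF that]]
    by (intro borel_measurable_times q(1) measurable_compose[OF _ Rm])
  have Fdiff: "norm2 ?L (\<lambda>x. F v x - F w x) \<le> \<kappa> * norm2 ?L (\<lambda>x. v x - w x)"
    if vw: "v \<in> X0 s \<Omega>" "w \<in> X0 s \<Omega>" for v w
  proof (rule square_integrable_dominated(2)[OF _ sqL[OF X0_diff[OF vw]] \<kappa>])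
    show "(\<lambda>x. F v x - F w x) \<in> borel_measurable ?L" using Fm vw by simp
    show "AE x in ?L. \<bar>F v x - F w x\<bar> \<le> \<kappa> * \<bar>v x - w x\<bar>"
      using q(2)
    proof eventually_elim
      case (elim x)
      have "\<bar>F v x - F w x\<bar> = \<bar>q x\<bar> * \<bar>R (v x) - R (w x)\<bar>"
        by (simp add: F_def abs_mult right_diff_distrib[symmetric])
      also have "\<dots> \<le> \<bar>Q\<bar> * (K * \<bar>v x - w x\<bar>)"
        using elim R(1) by (intro mult_mono) auto
      finally show ?case by (simp add: \<kappa>_def mult.assoc)
    qed
  qed
  have F0: "F (\<lambda>x. 0) = (\<lambda>x. 0)" by (simp add: F_def[abs_def] R(2))
  have Fle: "norm2 ?L (F v) \<le> \<kappa> * norm2 ?L v" if "v \<in> X0 s \<Omega>" for v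
    using Fdiff[OF that X0_zero] by (simp add: F0)
  have Fsq: "square_integrable ?L (F v)" if "v \<in> X0 s \<Omega>" for v
  proof (rule square_integrable_dominated(1)[OF Fm[OF that] sqL[OF that] \<kappa>])
    show "AE x in ?L. \<bar>F v x\<bar> \<le> \<kappa> * \<bar>v x\<bar>"
      using q(2)
    proof eventually_elim
      case (elim x)
      have "\<bar>F v x\<bar> = \<bar>q x\<bar> * \<bar>R (v x) - R 0\<bar>" by (simp add: F_def abs_mult R(2))
      also have "\<dots> \<le> \<bar>Q\<bar> * (K * \<bar>v x - 0\<bar>)"
        using elim R(1)[of "v x" 0] by (intro mult_mono) auto
      finally show ?case by (simp add: \<kappa>_def mult.assoc)
    qed
  qed
  from sol have uL2: "u \<in> L2_X0 s \<Omega> T" and init: "zero_initial \<Omega> T u"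
    by (simp_all add: finite_energy_solution_def)
  from sol obtain u' where u': "is_time_deriv s \<Omega> T u u'" and eqn: "\<And>\<phi>. \<phi> \<in> L2_X0 s \<Omega> T \<Longrightarrow>
      (LINT t|?M. u' t (\<phi> t)) + (LINT t|?M. energy s (u t) (\<phi> t)) =
      (LINT t|?M. LINT x|?L. q x * reaction \<alpha> (u t x) * \<phi> t x)"
    unfolding finite_energy_solution_def by blast
  obtain U G where Uu: "AE t in ?M. U t = u t" and U: "\<And>t. U t \<in> X0 s \<Omega>"
    and Gs: "\<And>n. simple_function ?M (G n)" and G: "\<And>n t. G n t \<in> X0 s \<Omega>"
    and Glim: "\<And>t. (\<lambda>n. X0_norm s (\<lambda>x. G n t x - U t x)) \<longlonglongrightarrow> 0"
    and Gle: "\<And>n t. X0_norm s (G n t) \<le> 2 * X0_norm s (U t)"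
    and Uint: "integrable ?M (\<lambda>t. (X0_norm s (U t))\<^sup>2)"
    using L2_X0_approx[OF s T uL2] by blast
  note Lipschitz_int = integrable_Lipschitz_functional[OF s T U Gs G Glim Gle Uint]
  have Uint1: "integrable ?M (\<lambda>t. X0_norm s (U t))"
    by (rule integrable_X0_norm[OF s T U Gs G Glim Gle Uint])
  define n2 where "n2 t = norm2 ?L (U t)" for t
  have n2_le: "n2 t \<le> P * X0_norm s (U t)" for t unfolding n2_def by (rule P(2)[OF U])
  have n2_nn: "0 \<le> n2 t" for t by (simp add: n2_def)
  have n2_int: "integrable ?M n2"
    unfolding n2_def[abs_def]
  proof (rule Lipschitz_int)
    show "\<bar>norm2 ?L v - norm2 ?L w\<bar> \<le> P * X0_norm s (\<lambda>x. v x - w x)" if "v \<in> X0 s \<Omega>" "w \<in> X0 s \<Omega>" for v w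
      using norm2_triangle_diff[OF sqL sqL, OF that] P(2)[OF X0_diff[OF that]] by linarith
  qed (simp add: norm2_def)
  have n2_sq: "square_integrable ?M n2"
  proof (rule square_integrable_dominated(1)[OF borel_measurable_integrable[OF n2_int]])
    show "square_integrable ?M (\<lambda>t. X0_norm s (U t))"
      using Uint Uint1 by (simp add: square_integrable_def)
    show "AE t in ?M. \<bar>n2 t\<bar> \<le> P * \<bar>X0_norm s (U t)\<bar>"
      unfolding abs_of_nonneg[OF n2_nn] abs_of_nonneg[OF nn] by (rule AE_I2, rule n2_le)
  qed (use P in simp)
  define g where "g v t = (LINT x|?L. U t x * v x)" for v t
  define f where "f v t = (LINT x|?L. F (U t) x * v x)" for v t
  define b where "b v t = f v t - energy s (U t) v" for v t
  have g_int: "integrable ?M (g v)" if v: "v \<in> X0 s \<Omega>" for v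
    unfolding g_def[abs_def]
  proof (rule Lipschitz_int)
    fix w w' assume w: "w \<in> X0 s \<Omega>" "w' \<in> X0 s \<Omega>"
    have "\<bar>(LINT x|?L. w x * v x) - (LINT x|?L. w' x * v x)\<bar> \<le> norm2 ?L v * norm2 ?L (\<lambda>x. w x - w' x)"
      using abs_integral_mult_diff_le[OF sqL[OF v] sqL[OF w(1)] sqL[OF w(2)]] by (simp add: mult.commute)
    also have "\<dots> \<le> norm2 ?L v * (P * X0_norm s (\<lambda>x. w x - w' x))"
      by (intro mult_left_mono P(2) X0_diff w) simp
    finally show "\<bar>(LINT x|?L. w x * v x) - (LINT x|?L. w' x * v x)\<bar> \<le> (norm2 ?L v * P) * X0_norm s (\<lambda>x. w x - w' x)"
      by (simp add: mult.assoc)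
  qed simp
  have f_int: "integrable ?M (f v)" if v: "v \<in> X0 s \<Omega>" for v
    unfolding f_def[abs_def]
  proof (rule Lipschitz_int)
    fix w w' assume w: "w \<in> X0 s \<Omega>" "w' \<in> X0 s \<Omega>"
    have "\<bar>(LINT x|?L. F w x * v x) - (LINT x|?L. F w' x * v x)\<bar> \<le> norm2 ?L v * norm2 ?L (\<lambda>x. F w x - F w' x)"
      using abs_integral_mult_diff_le[OF sqL[OF v] Fsq[OF w(1)] Fsq[OF w(2)]] by (simp add: mult.commute)
    also have "\<dots> \<le> norm2 ?L v * (\<kappa> * (P * X0_norm s (\<lambda>x. w x - w' x)))"
      by (intro mult_left_mono order_trans[OF Fdiff[OF w]] P(2) X0_diff w) (simp_all add: \<kappa>)
    finally show "\<bar>(LINT x|?L. F w x * v x) - (LINT x|?L. F w' x * v x)\<bar> \<le> (norm2 ?L v * \<kappa> * P) * X0_norm s (\<lambda>x. w x - w' x)"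
      by (simp add: mult.assoc)
  qed (simp add: F0)
  have E_int: "integrable ?M (\<lambda>t. energy s (U t) v)" if v: "v \<in> X0 s \<Omega>" for v
  proof (rule Lipschitz_int)
    fix w w' assume w: "w \<in> X0 s \<Omega>" "w' \<in> X0 s \<Omega>"
    show "\<bar>energy s w v - energy s w' v\<bar> \<le> X0_norm s v * X0_norm s (\<lambda>x. w x - w' x)"
      using abs_energy_le[OF s X0_diff[OF w] v] energy_diff_left[OF s v w] by (simp add: mult.commute)
  qed simp
  have b_int: "integrable ?M (b v)" if "v \<in> X0 s \<Omega>" for v
    unfolding b_def[abs_def] using f_int[OF that] E_int[OF that] by simp
  have b_diff: "\<bar>b v t - b w t\<bar> \<le> (1 + \<kappa> * P * P) * X0_norm s (\<lambda>x. v x - w x) * X0_norm s (U t)"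
    if vw: "v \<in> X0 s \<Omega>" "w \<in> X0 s \<Omega>" for v w t
  proof -
    have "\<bar>f v t - f w t\<bar> \<le> norm2 ?L (F (U t)) * norm2 ?L (\<lambda>x. v x - w x)"
      unfolding f_def by (rule abs_integral_mult_diff_le[OF Fsq[OF U] sqL[OF vw(1)] sqL[OF vw(2)]])
    also have "\<dots> \<le> (\<kappa> * (P * X0_norm s (U t))) * (P * X0_norm s (\<lambda>x. v x - w x))"
      by (intro mult_mono order_trans[OF Fle[OF U]] mult_left_mono P(2) U X0_diff vw)
        (use \<kappa> P nn in simp_all)
    finally have 1: "\<bar>f v t - f w t\<bar> \<le> \<kappa> * P * P * X0_norm s (\<lambda>x. v x - w x) * X0_norm s (U t)"
      by (simp add: mult_ac)
    have 2: "\<bar>energy s (U t) v - energy s (U t) w\<bar> \<le> X0_norm s (\<lambda>x. v x - w x) * X0_norm s (U t)"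
      using abs_energy_le[OF s U X0_diff[OF vw], of t] energy_diff_right[OF s U vw, of t] by (simp add: mult.commute)
    show ?thesis using 1 2 unfolding b_def by (simp add: distrib_right)
  qed
  \<comment> \<open>A version of the solution that tends to \<open>0\<close> as \<open>t \<rightarrow> 0\<close> only provides a bound for almost every
    small time, which is the form of the initial condition used for \<open>g v\<close>.\<close>
  have g_init: "\<exists>\<delta>>0. AE t in ?M. t < \<delta> \<longrightarrow> \<bar>g v t\<bar> \<le> \<epsilon>" if v: "v \<in> X0 s \<Omega>" and \<epsilon>: "0 < \<epsilon>" for v \<epsilon>
  proof -
    obtain w where w: "AE t in ?M. AE x in ?L. w t x = u t x" "\<And>t. t \<in> {0<..<T} \<Longrightarrow> L2_fun \<Omega> (w t)"
      "((\<lambda>t. L2_norm_on \<Omega> (w t)) \<longlongrightarrow> 0) (at_right 0)"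
      using init unfolding zero_initial_def by blast
    define \<epsilon>' where "\<epsilon>' = \<epsilon> / (norm2 ?L v + 1)"
    have \<epsilon>': "0 < \<epsilon>'" "\<epsilon>' * norm2 ?L v \<le> \<epsilon>"
      using \<epsilon> norm2_nonneg[of ?L v] by (auto simp: \<epsilon>'_def field_simps add_pos_nonneg)
    have "eventually (\<lambda>t. L2_norm_on \<Omega> (w t) < \<epsilon>') (at_right 0)"
      using order_tendstoD(2)[OF w(3) \<epsilon>'(1)] .
    then obtain \<delta> where \<delta>: "0 < \<delta>" "\<And>t. 0 < t \<Longrightarrow> t < \<delta> \<Longrightarrow> L2_norm_on \<Omega> (w t) < \<epsilon>'"
      unfolding eventually_at_right_field by blast
    have "AE t in ?M. t < \<delta> \<longrightarrow> \<bar>g v t\<bar> \<le> \<epsilon>"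
      using w(1) Uu AE_space
    proof eventually_elim
      case (elim t)
      show ?case
      proof
        assume "t < \<delta>"
        have "n2 t = L2_norm_on \<Omega> (w t)"
        proof -
          have "(LINT x|?L. (U t x)\<^sup>2) = (LINT x|?L. (w t x)\<^sup>2)"
            using elim(1,2) by (intro integral_cong_AE_lebesgue_on[OF \<Omega>m]) (auto elim: eventually_mono)
          then show ?thesis by (simp add: n2_def norm2_def L2_norm_on_def)
        qed
        then have "n2 t \<le> \<epsilon>'" using \<delta>(2)[of t] elim(3) \<open>t < \<delta>\<close> by simp
        then have "n2 t * norm2 ?L v \<le> \<epsilon>' * norm2 ?L v" by (rule mult_right_mono) simp
        moreover have "\<bar>g v t\<bar> \<le> n2 t * norm2 ?L v"
          unfolding g_def n2_def by (rule Cauchy_Schwarz_integral[OF sqL[OF U] sqL[OF v]])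
        ultimately show "\<bar>g v t\<bar> \<le> \<epsilon>" using \<epsilon>'(2) by linarith
      qed
    qed
    then show ?thesis using \<delta>(1) by blast
  qed
  \<comment> \<open>The test function \<open>\<phi>(t) v\<close> in the equation and the definition of the time derivative at \<open>v\<close>
    contain the same term \<open>\<integral> u'(t)(v) \<phi>(t) dt\<close>, which cancels.\<close>
  have g_weak: "(LINT t|?M. b v t * \<phi> t) = - (LINT t|?M. g v t * deriv \<phi> t)"
    if v: "v \<in> X0 s \<Omega>" and \<phi>: "test_fun T \<phi>" for v \<phi>
  proof -
    have d\<phi>: "\<phi> field_differentiable at t" for t
      using \<phi> unfolding test_fun_def by (metis funpow_0)
    have cont: "continuous_on A \<phi>" for A
      by (intro continuous_at_imp_continuous_on ballI field_differentiable_imp_continuous_at d\<phi>)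
    have \<phi>m: "\<phi> \<in> borel_measurable borel" by (intro borel_measurable_continuous_onI cont)
    have M: "{0<..<T} \<in> sets lebesgue" by simp
    have dual: "AE t in ?M. u' t \<in> X0_dual s \<Omega>"
      using u' by (auto simp: is_time_deriv_def L2_X0_dual_def bochner_L2_def strongly_measurable_in_def
        elim!: eventually_mono)
    have A: "(LINT t|?M. u' t (\<lambda>x. \<phi> t * v x)) = (LINT t|?M. u' t v * \<phi> t)"
    proof (rule integral_cong_AE_lebesgue_on[OF M])
      show "AE t in ?M. u' t (\<lambda>x. \<phi> t * v x) = u' t v * \<phi> t"
        using dual by eventually_elim (use v in \<open>simp add: X0_dual_def\<close>)
    qed
    have B: "(LINT t|?M. energy s (u t) (\<lambda>x. \<phi> t * v x)) = (LINT t|?M. energy s (U t) v * \<phi> t)"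
    proof (rule integral_cong_AE_lebesgue_on[OF M])
      show "AE t in ?M. energy s (u t) (\<lambda>x. \<phi> t * v x) = energy s (U t) v * \<phi> t"
        using Uu by eventually_elim (simp add: energy_scale_right)
    qed
    have C: "(LINT t|?M. LINT x|?L. q x * reaction \<alpha> (u t x) * (\<phi> t * v x)) = (LINT t|?M. f v t * \<phi> t)"
    proof (rule integral_cong_AE_lebesgue_on[OF M])
      show "AE t in ?M. (LINT x|?L. q x * reaction \<alpha> (u t x) * (\<phi> t * v x)) = f v t * \<phi> t"
        using Uu reaction_eq
      proof eventually_elim
        case (elim t)
        have "(LINT x|?L. q x * reaction \<alpha> (u t x) * (\<phi> t * v x)) = (LINT x|?L. F (U t) x * v x * \<phi> t)"
          using elim(2) unfolding elim(1)
          by (intro integral_cong_AE_lebesgue_on[OF \<Omega>m]) (auto simp: F_def elim!: eventually_mono)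
        then show ?case by (simp add: f_def)
      qed
    qed
    have D: "(LINT t|?M. (LINT x|?L. u t x * v x) * deriv \<phi> t) = (LINT t|?M. g v t * deriv \<phi> t)"
    proof (rule integral_cong_AE_lebesgue_on[OF M])
      show "AE t in ?M. (LINT x|?L. u t x * v x) * deriv \<phi> t = g v t * deriv \<phi> t"
        using Uu by eventually_elim (simp add: g_def)
    qed
    have "(LINT t|?M. u' t v * \<phi> t) = - (LINT t|?M. g v t * deriv \<phi> t)"
      using u' v \<phi> unfolding is_time_deriv_def D[symmetric] by blast
    moreover have "(LINT t|?M. u' t v * \<phi> t) + (LINT t|?M. energy s (U t) v * \<phi> t) = (LINT t|?M. f v t * \<phi> t)"
      using eqn[OF separated_in_L2_X0[OF v cont]] unfolding A B C .
    moreover have "(LINT t|?M. b v t * \<phi> t) = (LINT t|?M. f v t * \<phi> t) - (LINT t|?M. energy s (U t) v * \<phi> t)"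
      using integrable_mult_continuous[OF f_int[OF v] cont \<phi>m] integrable_mult_continuous[OF E_int[OF v] cont \<phi>m]
      by (simp add: b_def left_diff_distrib)
    ultimately show ?thesis by linarith
  qed
  define V where "V = (\<Union>n. G n ` space ?M)"
  have V: "countable V" "V \<subseteq> X0 s \<Omega>"
    using simple_functionD(1)[OF Gs] G by (auto simp: V_def intro: countable_finite)
  have primitive: "AE \<tau> in ?M. \<forall>v\<in>V. g v \<tau> = (LINT \<sigma>|?M. indicator {..<\<tau>} \<sigma> * b v \<sigma>)"
    unfolding AE_ball_countable[OF V(1)]
  proof
    fix v assume "v \<in> V"
    then have v: "v \<in> X0 s \<Omega>" using V(2) by blast
    show "AE \<tau> in ?M. g v \<tau> = (LINT \<sigma>|?M. indicator {..<\<tau>} \<sigma> * b v \<sigma>)"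
      by (rule weak_derivative_imp_primitive[OF T g_int[OF v] b_int[OF v] g_weak[OF v] g_init[OF v]])
  qed
  define e where "e \<tau> = (LINT \<sigma>|?M. indicator {..<\<tau>} \<sigma> * energy s (U \<sigma>) (U \<tau>))" for \<tau>
  define m where "m c = (LINT \<sigma>|?M. indicator {..<c} \<sigma> * n2 \<sigma>)" for c
  \<comment> \<open>The identity for \<open>v = G n \<tau>\<close> passes to the limit \<open>v = U \<tau>\<close> in the energy norm.\<close>
  have pointwise: "AE \<tau> in ?M. (n2 \<tau>)\<^sup>2 \<le> - e \<tau> + \<kappa> * m \<tau> * n2 \<tau>"
    using primitive AE_space
  proof eventually_elim
    case (elim \<tau>)
    have "(\<lambda>n. g (G n \<tau>) \<tau> - g (U \<tau>) \<tau>) \<longlonglongrightarrow> 0"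
    proof (rule Lim_null_comparison)
      show "(\<lambda>n. n2 \<tau> * P * X0_norm s (\<lambda>x. G n \<tau> x - U \<tau> x)) \<longlonglongrightarrow> 0"
        using tendsto_mult_left[OF Glim, of "n2 \<tau> * P" \<tau>] by simp
      show "\<forall>\<^sub>F n in sequentially. norm (g (G n \<tau>) \<tau> - g (U \<tau>) \<tau>) \<le> n2 \<tau> * P * X0_norm s (\<lambda>x. G n \<tau> x - U \<tau> x)"
      proof (intro always_eventually allI)
        fix n
        have "norm (g (G n \<tau>) \<tau> - g (U \<tau>) \<tau>) \<le> n2 \<tau> * norm2 ?L (\<lambda>x. G n \<tau> x - U \<tau> x)"
          unfolding g_def n2_def real_norm_def
          by (rule abs_integral_mult_diff_le[OF sqL[OF U] sqL[OF G] sqL[OF U]])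
        also have "\<dots> \<le> n2 \<tau> * (P * X0_norm s (\<lambda>x. G n \<tau> x - U \<tau> x))"
          by (intro mult_left_mono P(2) X0_diff G U n2_nn)
        finally show "norm (g (G n \<tau>) \<tau> - g (U \<tau>) \<tau>) \<le> n2 \<tau> * P * X0_norm s (\<lambda>x. G n \<tau> x - U \<tau> x)"
          by (simp add: mult.assoc)
      qed
    qed
    then have lim1: "(\<lambda>n. g (G n \<tau>) \<tau>) \<longlonglongrightarrow> g (U \<tau>) \<tau>" by (rule LIM_zero_cancel)
    define I where "I v = (LINT \<sigma>|?M. indicator {..<\<tau>} \<sigma> * b v \<sigma>)" for v
    define J where "J = (LINT \<sigma>|?M. X0_norm s (U \<sigma>))"
    have "(\<lambda>n. I (G n \<tau>) - I (U \<tau>)) \<longlonglongrightarrow> 0"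
    proof (rule Lim_null_comparison)
      show "(\<lambda>n. (1 + \<kappa> * P * P) * J * X0_norm s (\<lambda>x. G n \<tau> x - U \<tau> x)) \<longlonglongrightarrow> 0"
        using tendsto_mult_left[OF Glim, of "(1 + \<kappa> * P * P) * J" \<tau>] by simp
      show "\<forall>\<^sub>F n in sequentially. norm (I (G n \<tau>) - I (U \<tau>)) \<le> (1 + \<kappa> * P * P) * J * X0_norm s (\<lambda>x. G n \<tau> x - U \<tau> x)"
      proof (intro always_eventually allI)
        fix n
        note ints = integrable_mult_halfline[OF b_int[OF G[of n \<tau>]], of \<tau>] integrable_mult_halfline[OF b_int[OF U[of \<tau>]], of \<tau>]
        have I_diff: "I (G n \<tau>) - I (U \<tau>) = (LINT \<sigma>|?M. indicator {..<\<tau>} \<sigma> * b (G n \<tau>) \<sigma> - indicator {..<\<tau>} \<sigma> * b (U \<tau>) \<sigma>)"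
          using ints by (simp add: I_def)
        have "norm (I (G n \<tau>) - I (U \<tau>)) \<le> (LINT \<sigma>|?M. norm (indicator {..<\<tau>} \<sigma> * b (G n \<tau>) \<sigma> - indicator {..<\<tau>} \<sigma> * b (U \<tau>) \<sigma>))"
          unfolding I_diff by (rule integral_norm_bound)
        also have "\<dots> \<le> (LINT \<sigma>|?M. (1 + \<kappa> * P * P) * X0_norm s (\<lambda>x. G n \<tau> x - U \<tau> x) * X0_norm s (U \<sigma>))"
        proof (rule integral_mono)
          fix \<sigma>
          show "norm (indicator {..<\<tau>} \<sigma> * b (G n \<tau>) \<sigma> - indicator {..<\<tau>} \<sigma> * b (U \<tau>) \<sigma>)
              \<le> (1 + \<kappa> * P * P) * X0_norm s (\<lambda>x. G n \<tau> x - U \<tau> x) * X0_norm s (U \<sigma>)"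
          proof (cases "\<sigma> < \<tau>")
            case True
            then show ?thesis using b_diff[OF G[of n \<tau>] U[of \<tau>], of \<sigma>] by simp
          next
            case False
            have "0 \<le> (1 + \<kappa> * P * P) * X0_norm s (\<lambda>x. G n \<tau> x - U \<tau> x) * X0_norm s (U \<sigma>)"
              using \<kappa> P(1) by (intro mult_nonneg_nonneg nn) simp
            with False show ?thesis by simp
          qed
        next
          show "integrable ?M (\<lambda>\<sigma>. norm (indicator {..<\<tau>} \<sigma> * b (G n \<tau>) \<sigma> - indicator {..<\<tau>} \<sigma> * b (U \<tau>) \<sigma>))"
            by (intro integrable_norm Bochner_Integration.integrable_diff ints)
          show "integrable ?M (\<lambda>\<sigma>. (1 + \<kappa> * P * P) * X0_norm s (\<lambda>x. G n \<tau> x - U \<tau> x) * X0_norm s (U \<sigma>))"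
            by (rule integrable_mult_right[OF Uint1])
        qed
        finally show "norm (I (G n \<tau>) - I (U \<tau>)) \<le> (1 + \<kappa> * P * P) * J * X0_norm s (\<lambda>x. G n \<tau> x - U \<tau> x)"
          by (simp add: J_def mult_ac)
      qed
    qed
    then have lim2: "(\<lambda>n. I (G n \<tau>)) \<longlonglongrightarrow> I (U \<tau>)" by (rule LIM_zero_cancel)
    have "g (G n \<tau>) \<tau> = I (G n \<tau>)" for n
    proof -
      have "G n \<tau> \<in> V" using elim(2) unfolding V_def by (intro UN_I[of n] imageI) simp_all
      then show ?thesis unfolding I_def by (rule elim(1)[rule_format])
    qed
    then have gI: "g (U \<tau>) \<tau> = I (U \<tau>)"
      using LIMSEQ_unique[OF lim1] lim2 by simp
    have "(n2 \<tau>)\<^sup>2 = g (U \<tau>) \<tau>"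
      unfolding n2_def norm2_power2 g_def by (simp add: power2_eq_square)
    also have "\<dots> = (LINT \<sigma>|?M. indicator {..<\<tau>} \<sigma> * f (U \<tau>) \<sigma>) - e \<tau>"
      unfolding gI I_def b_def e_def
      using integrable_mult_halfline[OF f_int[OF U[of \<tau>]], of \<tau>] integrable_mult_halfline[OF E_int[OF U[of \<tau>]], of \<tau>]
      by (simp add: right_diff_distrib)
    also have "(LINT \<sigma>|?M. indicator {..<\<tau>} \<sigma> * f (U \<tau>) \<sigma>) \<le> (LINT \<sigma>|?M. \<kappa> * n2 \<tau> * (indicator {..<\<tau>} \<sigma> * n2 \<sigma>))"
    proof (rule integral_mono)
      fix \<sigma>
      have "f (U \<tau>) \<sigma> \<le> norm2 ?L (F (U \<sigma>)) * n2 \<tau>"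
        using Cauchy_Schwarz_integral[OF Fsq[OF U] sqL[OF U], of \<sigma> \<tau>] unfolding f_def n2_def by linarith
      also have "\<dots> \<le> \<kappa> * n2 \<sigma> * n2 \<tau>"
        using Fle[OF U, of \<sigma>] by (intro mult_right_mono n2_nn) (simp add: n2_def)
      finally show "indicator {..<\<tau>} \<sigma> * f (U \<tau>) \<sigma> \<le> \<kappa> * n2 \<tau> * (indicator {..<\<tau>} \<sigma> * n2 \<sigma>)"
        by (cases "\<sigma> < \<tau>") (simp_all add: mult_ac)
    next
      show "integrable ?M (\<lambda>\<sigma>. indicator {..<\<tau>} \<sigma> * f (U \<tau>) \<sigma>)"
        by (rule integrable_mult_halfline[OF f_int[OF U]])
      show "integrable ?M (\<lambda>\<sigma>. \<kappa> * n2 \<tau> * (indicator {..<\<tau>} \<sigma> * n2 \<sigma>))"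
        by (rule integrable_mult_right[OF integrable_mult_halfline[OF n2_int]])
    qed
    finally have "(n2 \<tau>)\<^sup>2 \<le> \<kappa> * n2 \<tau> * m \<tau> - e \<tau>"
      unfolding m_def by (simp only: integral_mult_right_zero)
    then show ?case by (simp add: mult_ac)
  qed
  have estimate: "(LINT \<tau>|?M. indicator {..<c} \<tau> * (n2 \<tau>)\<^sup>2) \<le> \<kappa> * (LINT \<tau>|?M. indicator {..<c} \<tau> * n2 \<tau>)\<^sup>2" for c
  proof -
    \<comment> \<open>Cutting off \<open>U\<close> at time \<open>c\<close> turns the integral over \<open>\<sigma> < \<tau> < c\<close> into one over \<open>\<sigma> < \<tau>\<close>.\<close>
    define Uc where "Uc t = (if t \<in> {..<c} then U t else (\<lambda>x. 0))" for t
    define Gc where "Gc n t = (if t \<in> {..<c} then G n t else (\<lambda>x. 0))" for n t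
    have c1: "Uc t \<in> X0 s \<Omega>" for t by (simp add: Uc_def U X0_zero)
    have c2: "simple_function ?M (Gc n)" for n
      unfolding Gc_def[abs_def]
      by (intro simple_function_If_set[OF Gs] simple_function_const)
        (simp, subst Int_commute, rule sets_time_measure_halfline)
    have c3: "Gc n t \<in> X0 s \<Omega>" for n t by (simp add: Gc_def G X0_zero)
    have c4: "(\<lambda>n. X0_norm s (\<lambda>x. Gc n t x - Uc t x)) \<longlonglongrightarrow> 0" for t
      using Glim[of t] by (cases "t < c") (simp_all add: Gc_def Uc_def)
    have c5: "X0_norm s (Gc n t) \<le> 2 * X0_norm s (Uc t)" for n t
      using Gle[of n t] by (cases "t < c") (simp_all add: Gc_def Uc_def)
    have "(\<lambda>t. (X0_norm s (Uc t))\<^sup>2) = (\<lambda>t. indicat_real {..<c} t * (X0_norm s (U t))\<^sup>2)"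
      by (auto simp: Uc_def split: split_indicator)
    then have c6: "integrable ?M (\<lambda>t. (X0_norm s (Uc t))\<^sup>2)"
      using integrable_mult_halfline[OF Uint, of c] by simp
    have ec: "(LINT \<sigma>|?M. indicator {..<\<tau>} \<sigma> * energy s (Uc \<sigma>) (Uc \<tau>)) = indicator {..<c} \<tau> * e \<tau>" for \<tau>
    proof (cases "\<tau> < c")
      case True
      then show ?thesis unfolding e_def
        by (auto simp: Uc_def split: split_indicator intro!: Bochner_Integration.integral_cong)
    next
      case False
      then show ?thesis by (simp add: Uc_def)
    qed
    note tri = energy_triangle_integral[OF s T c1 c2 c3 c4 c5 c6, unfolded ec]
    have n2c: "integrable ?M (\<lambda>\<tau>. indicator {..<c} \<tau> * n2 \<tau>)" by (rule integrable_mult_halfline[OF n2_int])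
    have "(LINT \<tau>|?M. indicator {..<c} \<tau> * (n2 \<tau>)\<^sup>2)
        \<le> (LINT \<tau>|?M. - (indicator {..<c} \<tau> * e \<tau>) + \<kappa> * m c * (indicator {..<c} \<tau> * n2 \<tau>))"
    proof (rule integral_mono_AE)
      show "integrable ?M (\<lambda>\<tau>. indicator {..<c} \<tau> * (n2 \<tau>)\<^sup>2)"
        using n2_sq by (intro integrable_mult_halfline) (simp add: square_integrable_def)
      show "integrable ?M (\<lambda>\<tau>. - (indicator {..<c} \<tau> * e \<tau>) + \<kappa> * m c * (indicator {..<c} \<tau> * n2 \<tau>))"
        using tri(1) n2c by simp
      show "AE \<tau> in ?M. indicator {..<c} \<tau> * (n2 \<tau>)\<^sup>2 \<le> - (indicator {..<c} \<tau> * e \<tau>) + \<kappa> * m c * (indicator {..<c} \<tau> * n2 \<tau>)"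
        using pointwise
      proof eventually_elim
        case (elim \<tau>)
        show ?case
        proof (cases "\<tau> < c")
          case True
          have "m \<tau> \<le> m c"
            unfolding m_def using True n2_nn
            by (intro integral_mono integrable_mult_halfline n2_int) (auto split: split_indicator)
          then have "\<kappa> * m \<tau> * n2 \<tau> \<le> \<kappa> * m c * n2 \<tau>"
            using \<kappa> n2_nn by (intro mult_right_mono mult_left_mono)
          with elim True show ?thesis by simp
        qed simp
      qed
    qed
    also have "\<dots> = - (LINT \<tau>|?M. indicator {..<c} \<tau> * e \<tau>) + \<kappa> * m c * (LINT \<tau>|?M. indicator {..<c} \<tau> * n2 \<tau>)"
      using tri(1) n2c by simp
    also have "\<dots> \<le> \<kappa> * m c * m c" using tri(2) by (simp add: m_def)
    finally show ?thesis by (simp add: m_def power2_eq_square mult.assoc)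
  qed
  have "AE t in ?M. n2 t = 0"
    by (rule AE_zero_of_short_time_estimate[OF T \<kappa> n2_sq estimate])
  then show ?thesis using Uu
  proof eventually_elim
    case (elim t)
    have "AE x in ?L. U t x = 0"
      using elim(1) norm2_eq_0_iff[OF sqL[OF U]] by (simp add: n2_def)
    then have "AE x in lebesgue. x \<in> \<Omega> \<longrightarrow> U t x = 0"
      using \<Omega>m by (simp add: AE_restrict_space_iff)
    moreover have "AE x in lebesgue. x \<notin> \<Omega> \<longrightarrow> U t x = 0" using U[of t] by (simp add: X0_iff)
    ultimately show ?case unfolding elim(2)[symmetric] by eventually_elim blast
  qed
qed

lemma reaction_minus: "reaction \<alpha> (- r) = - reaction \<alpha> r"
  by (simp add: reaction_def)

text \<open>For positive arguments this is the mean value theorem. The difference to the value at \<open>0\<close>, where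
  the power need not be differentiable, is estimated directly; oddness gives the negative
  arguments, and \<open>0\<close> separates arguments of opposite signs.\<close>

lemma reaction_Lipschitz_on_interval:
  assumes \<alpha>: "1 \<le> \<alpha>" and ab: "\<bar>a\<bar> \<le> C" "\<bar>b\<bar> \<le> C"
  shows "\<bar>reaction \<alpha> a - reaction \<alpha> b\<bar> \<le> \<alpha> * C powr (\<alpha> - 1) * \<bar>a - b\<bar>"
proof -
  let ?K = "\<alpha> * C powr (\<alpha> - 1)"
  have zero: "\<bar>reaction \<alpha> b - reaction \<alpha> 0\<bar> \<le> ?K * b" if "0 \<le> b" "b \<le> C" for b
  proof -
    have "b powr (\<alpha> - 1) \<le> C powr (\<alpha> - 1)"
      using that \<alpha> by (intro powr_mono2) auto
    also have "\<dots> \<le> ?K" using \<alpha> by (simp add: mult_le_cancel_right1)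
    finally show ?thesis using that by (simp add: reaction_def mult_right_mono)
  qed
  have pos: "\<bar>reaction \<alpha> b - reaction \<alpha> a\<bar> \<le> ?K * (b - a)" if ab: "0 \<le> a" "a \<le> b" "b \<le> C" for a b
  proof -
    consider "a = 0" | "a = b" | "0 < a" "a < b" using ab by linarith
    then show ?thesis
    proof cases
      case 1
      then show ?thesis using zero[of b] ab by simp
    next
      case 3
      have eq: "reaction \<alpha> x = x powr \<alpha>" if "0 < x" for x
        using that powr_mult_base[of x "\<alpha> - 1"] by (simp add: reaction_def mult.commute)
      have "\<exists>z>a. z < b \<and> b powr \<alpha> - a powr \<alpha> = (b - a) * (\<alpha> * z powr (\<alpha> - 1))"
        by (rule MVT2[OF 3(2)]) (use 3 in \<open>auto intro!: derivative_eq_intros\<close>)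
      then obtain z where z: "a < z" "z < b" "b powr \<alpha> - a powr \<alpha> = (b - a) * (\<alpha> * z powr (\<alpha> - 1))" by blast
      have "z powr (\<alpha> - 1) \<le> C powr (\<alpha> - 1)"
        using z 3 ab \<alpha> by (intro powr_mono2) auto
      then have "(b - a) * (\<alpha> * z powr (\<alpha> - 1)) \<le> (b - a) * ?K"
        using 3 \<alpha> by (intro mult_left_mono) auto
      moreover have "0 \<le> (b - a) * (\<alpha> * z powr (\<alpha> - 1))" using 3 \<alpha> by simp
      ultimately show ?thesis using z(3) 3 by (simp add: eq mult.commute)
    qed simp
  qed
  have le: "\<bar>reaction \<alpha> b - reaction \<alpha> a\<bar> \<le> ?K * (b - a)" if "a \<le> b" "\<bar>a\<bar> \<le> C" "\<bar>b\<bar> \<le> C" for a b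
  proof -
    consider "0 \<le> a" | "b \<le> 0" | "a < 0" "0 < b" by linarith
    then show ?thesis
    proof cases
      case 1
      then show ?thesis using pos[of a b] that by simp
    next
      case 2
      then show ?thesis using pos[of "- b" "- a"] that by (simp add: reaction_minus)
    next
      case 3
      have "reaction \<alpha> 0 = 0" by (simp add: reaction_def)
      then have "\<bar>reaction \<alpha> b\<bar> \<le> ?K * b" "\<bar>reaction \<alpha> a\<bar> \<le> ?K * (- a)"
        using zero[of b] zero[of "- a"] 3 that by (simp_all add: reaction_minus)
      then have "\<bar>reaction \<alpha> b - reaction \<alpha> a\<bar> \<le> ?K * b + ?K * (- a)" by linarith
      then show ?thesis by (simp add: right_diff_distrib)
    qed
  qed
  show ?thesis
    using le[of a b] le[of b a] ab by (cases "a \<le> b") (simp_all add: abs_minus_commute)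
qed

lemma zero_finite_energy_solution:
  "finite_energy_solution s \<Omega> T \<alpha> q (\<lambda>t x. 0)"
  for \<Omega> :: "'a::euclidean_space set"
proof -
  let ?Z = "\<lambda>x :: 'a. 0 :: real" and ?F = "\<lambda>v :: 'a \<Rightarrow> real. 0 :: real"
  have L2: "(\<lambda>t. ?Z) \<in> L2_X0 s \<Omega> T"
    using separated_in_L2_X0[where v = ?Z and \<phi> = "\<lambda>_. 0" and s = s and \<Omega> = \<Omega> and T = T] X0_zero[of s \<Omega>]
    by simp
  have init: "zero_initial \<Omega> T (\<lambda>t. ?Z)"
    unfolding zero_initial_def
    by (intro exI[of _ "\<lambda>t. ?Z"]) (simp add: L2_fun_def L2_norm_on_def)
  have Fnorm: "X0_dual_norm s \<Omega> ?F = 0"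
  proof -
    have "{v \<in> X0 s \<Omega>. X0_norm s v \<le> 1} \<noteq> {}" using X0_zero[of s \<Omega>] by (auto intro!: exI[of _ ?Z])
    then show ?thesis by (simp add: X0_dual_norm_def)
  qed
  have F: "?F \<in> X0_dual s \<Omega>"
    by (auto simp: X0_dual_def intro!: exI[of _ 0])
  have "(\<lambda>t. ?F) \<in> L2_X0_dual s \<Omega> T"
    unfolding L2_X0_dual_def bochner_L2_def strongly_measurable_in_def
    using F Fnorm by (auto intro!: exI[of _ "\<lambda>n t. ?F"] simp: fun_diff_def)
  then have deriv: "is_time_deriv s \<Omega> T (\<lambda>t. ?Z) (\<lambda>t. ?F)"
    by (simp add: is_time_deriv_def)
  have "reaction \<alpha> 0 = 0" by (simp add: reaction_def)
  then show ?thesis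
    unfolding finite_energy_solution_def using L2 init deriv
    by (intro conjI exI[of _ "\<lambda>t. ?F"]) simp_all
qed

theorem proposition1p2:
  fixes \<Omega> :: "(real ^ 'n) set" and s T \<alpha> :: real and q :: "real ^ 'n \<Rightarrow> real"
  assumes "bounded \<Omega>" and "lipschitz_domain \<Omega>"
    and "0 < s" and "s < 1" and "0 < T" and "1 \<le> \<alpha>"
    and "q \<in> borel_measurable (lebesgue_on \<Omega>)"
    and "\<exists>C. AE x in lebesgue_on \<Omega>. \<bar>q x\<bar> \<le> C"
    and "AE x in lebesgue_on \<Omega>. 0 \<le> q x"
    and "\<exists>G q0. open G \<and> G \<noteq> {} \<and> G \<subseteq> \<Omega> \<and> 0 < q0 \<and> (AE x in lebesgue_on G. q0 \<le> q x)"
  shows "(\<alpha> = 1 \<longrightarrow>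
           finite_energy_solution s \<Omega> T \<alpha> q (\<lambda>t x. 0) \<and>
           (\<forall>u. finite_energy_solution s \<Omega> T \<alpha> q u \<longrightarrow>
              (AE t in time_measure T. AE x in lebesgue. u t x = 0))) \<and>
         (\<alpha> > 1 \<longrightarrow>
           finite_energy_solution s \<Omega> T \<alpha> q (\<lambda>t x. 0) \<and> ess_bounded \<Omega> T (\<lambda>t x. 0) \<and>
           (\<forall>u. finite_energy_solution s \<Omega> T \<alpha> q u \<and> ess_bounded \<Omega> T u \<longrightarrow>
              (AE t in time_measure T. AE x in lebesgue. u t x = 0)))"
proof (intro conjI impI allI zero_finite_energy_solution)
  obtain Q where Q: "AE x in lebesgue_on \<Omega>. \<bar>q x\<bar> \<le> Q" using assms(8) by blast
  have "open \<Omega>" using assms(2) by (simp add: lipschitz_domain_def)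
  note unique = solution_eq_zero_if_Lipschitz[OF assms(1) this assms(3-5) assms(7) Q]
  show "AE t in time_measure T. AE x in lebesgue. u t x = 0"
    if \<alpha>: "\<alpha> = 1" and sol: "finite_energy_solution s \<Omega> T \<alpha> q u" for u
  proof (rule unique[where R = "\<lambda>r. r" and K = 1, OF _ _ sol])
    have "reaction \<alpha> r = r" for r using \<alpha> by (simp add: reaction_def)
    then show "AE t in time_measure T. AE x in lebesgue_on \<Omega>. reaction \<alpha> (u t x) = u t x" by simp
  qed simp_all
  show "AE t in time_measure T. AE x in lebesgue. u t x = 0"
    if \<alpha>: "\<alpha> > 1" and u: "finite_energy_solution s \<Omega> T \<alpha> q u \<and> ess_bounded \<Omega> T u" for u
  proof -
    obtain C where C: "AE t in time_measure T. AE x in lebesgue_on \<Omega>. \<bar>u t x\<bar> \<le> C"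
      using u unfolding ess_bounded_def by blast
    \<comment> \<open>Truncation at the bound of \<open>u\<close> makes the power globally Lipschitz without changing it along \<open>u\<close>.\<close>
    define clamp where "clamp r = max (- \<bar>C\<bar>) (min \<bar>C\<bar> r)" for r
    have clamp: "\<bar>clamp a\<bar> \<le> \<bar>C\<bar>" "\<bar>clamp a - clamp b\<bar> \<le> \<bar>a - b\<bar>" for a b
      unfolding clamp_def by linarith+
    show ?thesis
    proof (rule unique[where R = "\<lambda>r. reaction \<alpha> (clamp r)" and K = "\<alpha> * \<bar>C\<bar> powr (\<alpha> - 1)", OF _ _ conjunct1[OF u]])
      fix a b
      have "\<bar>reaction \<alpha> (clamp a) - reaction \<alpha> (clamp b)\<bar> \<le> \<alpha> * \<bar>C\<bar> powr (\<alpha> - 1) * \<bar>clamp a - clamp b\<bar>"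
        using \<alpha> clamp(1) by (intro reaction_Lipschitz_on_interval) auto
      also have "\<dots> \<le> \<alpha> * \<bar>C\<bar> powr (\<alpha> - 1) * \<bar>a - b\<bar>"
        using \<alpha> clamp(2) by (intro mult_left_mono) auto
      finally show "\<bar>reaction \<alpha> (clamp a) - reaction \<alpha> (clamp b)\<bar> \<le> \<alpha> * \<bar>C\<bar> powr (\<alpha> - 1) * \<bar>a - b\<bar>" .
      show "reaction \<alpha> (clamp 0) = 0" by (simp add: clamp_def reaction_def)
      show "AE t in time_measure T. AE x in lebesgue_on \<Omega>. reaction \<alpha> (u t x) = reaction \<alpha> (clamp (u t x))"
        using C
      proof eventually_elim
        case (elim t)
        then show ?case
        proof eventually_elim
          case (elim x)
          then have "clamp (u t x) = u t x" by (auto simp: clamp_def)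
          then show ?case by simp
        qed
      qed
    qed
  qed
  show "ess_bounded \<Omega> T (\<lambda>t x. 0)"
    unfolding ess_bounded_def by (intro exI[of _ 0]) simp
qed

end
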